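(* Let $\mu$ be a non-atomic Borel probability measure on $\mathbb{R}^d$ with $\mu(R)=0$, let $\alpha>0$, and let $(x_n)_{n=1}^\infty$ be a sequence of independent random points of $\mathbb{R}^d$, each distributed according to $\mu$. Consider the random set \[ E_\alpha=\limsup_nB(x_n,n^{-\alpha})=\bigcap_{k\ge1}\bigcup_{n\ge k}B(x_n,n^{-\alpha}). \] Let \[ s=s(\mu)=\lim_{\varepsilon\to0^+}\sup\{\,t:G_\mu(t)\ge t-\varepsilon\,\}, \] and suppose that $1/\alpha\le s$. Then, almost surely, $E_\alpha\in\mathscr{G}_\mu^\theta$ with $\theta=(\alpha s)^{-1}$, and \[ \dim_{\mathrm H}E_\alpha\ge\frac1\alpha\,\frac{\overline{\dim}_{\mathrm H}\,\mu}{s}. \]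
   Context: $\dim_{\mathrm H}$ denotes Hausdorff dimension and $B(x,r)$ is the open ball with centre $x$ and radius $r$. Fix a point $P=(p_1,\dots,p_d)\in\mathbb{R}^d$. For $n\in\mathbb{Z}$, $\mathscr{D}_n$ is the collection of half-open cubes $\prod_{i=1}^d[p_i+n_i2^{-n},\,p_i+(n_i+1)2^{-n})$ with $n_1,\dots,n_d\in\mathbb{Z}$, and $\mathscr{D}=\bigcup_{n\in\mathbb{Z}}\mathscr{D}_n$ (dyadic cubes). $R=\bigcup_{n\in\mathbb{Z}}\bigcup_{D\in\mathscr{D}_n}\partial D$ is the union of all boundaries of dyadic cubes; the point $P$ is chosen so that $\mu(R)=0$ (which is always possible). For $0<\theta\le1$ and $E\subset\mathbb{R}^d$, $\mathscr{M}_\mu^\theta(E)=\inf\{\sum_k\mu(D_k)^\theta : D_k\in\mathscr{D},\ E\subset\bigcup_kD_k\}$ (infimum over countable covers by dyadic cubes). For $0<\theta\le1$, a set $E\subset\mathbb{R}^d$ belongs to the class $\mathscr{G}_\mu^\theta$ if $E$ is a $G_\delta$-set and $\mathscr{M}_\mu^\eta(E\cap D)=\mathscr{M}_\mu^\eta(D)$ for every $0<\eta<\theta$ and every $D\in\mathscr{D}$. The upper coarse multifractal spectrum of $\mu$ is \[ G_\mu(s)=\lim_{\varepsilon\to0}\limsup_{r\to0}\frac{\log(N(s+\varepsilon,r)-N(s-\varepsilon,r))}{-\log r}, \] where $N(s,r)$ is the number of cubes $Q=[k_1r,(k_1+1)r)\times\cdots\times[k_dr,(k_d+1)r)$, $k_1,\dots,k_d\in\mathbb{Z}$,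 with $\mu(Q)\ge r^s$; here $\log0=-\infty$. The lower local dimension of $\mu$ at $x$ is $\underline{d}_\mu(x)=\liminf_{r\to0}\frac{\log\mu(B(x,r))}{\log r}$, and the upper Hausdorff dimension of $\mu$ is $\overline{\dim}_{\mathrm H}\,\mu=\operatorname{ess\,sup}_\mu\underline{d}_\mu=\inf\{\dim_{\mathrm H}A:\mu(A^\complement)=0\}$. *)

theory Defs
  imports "HOL-Probability.Probability"
begin

definition dyadic_cube :: "real^'n \<Rightarrow> int \<Rightarrow> ('n \<Rightarrow> int) \<Rightarrow> (real^'n) set" where
  "dyadic_cube P n k =
     {x. \<forall>i. P $ i + of_int (k i) * 2 powi (- n) \<le> x $ i \<and>
              x $ i < P $ i + of_int (k i + 1) * 2 powi (- n)}"

definition dyadic_cubes_of :: "real^'n \<Rightarrow> int \<Rightarrow> (real^'n) set set" where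
  "dyadic_cubes_of P n = range (dyadic_cube P n)"

definition dyadic_cubes :: "real^'n \<Rightarrow> (real^'n) set set" where
  "dyadic_cubes P = (\<Union>n. dyadic_cubes_of P n)"

definition dyadic_boundaries :: "real^'n \<Rightarrow> (real^'n) set" where
  "dyadic_boundaries P = (\<Union>n. \<Union>D\<in>dyadic_cubes_of P n. frontier D)"


definition dyadic_content :: "real^'n \<Rightarrow> (real^'n) measure \<Rightarrow> real \<Rightarrow> (real^'n) set \<Rightarrow> ennreal" where
  "dyadic_content P \<mu> \<theta> E =
     (INF C\<in>{C. countable C \<and> C \<subseteq> dyadic_cubes P \<and> E \<subseteq> \<Union>C}.
        \<Sum>\<^sub>\<infinity>D\<in>C. ennreal (measure \<mu> D powr \<theta>))"

text \<open>The definition is meant for \<open>0 < \<theta> \<le> 1\<close>. For \<open>\<theta> \<le> 0\<close> the second condition is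
  vacuous and the class consists of all \<open>G\<^sub>\<delta>\<close>-sets.\<close>

definition class_G :: "real^'n \<Rightarrow> (real^'n) measure \<Rightarrow> real \<Rightarrow> (real^'n) set set" where
  "class_G P \<mu> \<theta> =
     {E. gdelta_in euclidean E \<and>
         (\<forall>\<eta> D. 0 < \<eta> \<and> \<eta> < \<theta> \<and> D \<in> dyadic_cubes P \<longrightarrow>
            dyadic_content P \<mu> \<eta> (E \<inter> D) = dyadic_content P \<mu> \<eta> D)}"


text \<open>Only bounded sets are admitted in covers, because \<^const>\<open>diameter\<close> is 0 on unbounded
  sets. Only exponents \<open>s > 0\<close> are used, because \<open>0 powr 0 = 0\<close>; this does not change the
  infimum that defines the dimension.\<close>

definition hausdorff_premeasure :: "real \<Rightarrow> real \<Rightarrow> 'a::metric_space set \<Rightarrow> ennreal" where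
  "hausdorff_premeasure s \<delta> E =
     (INF C\<in>{C. countable C \<and> (\<forall>U\<in>C. bounded U \<and> diameter U \<le> \<delta>) \<and> E \<subseteq> \<Union>C}.
        \<Sum>\<^sub>\<infinity>U\<in>C. ennreal (diameter U powr s))"

definition hausdorff_measure :: "real \<Rightarrow> 'a::metric_space set \<Rightarrow> ennreal" where
  "hausdorff_measure s E = (SUP \<delta>\<in>{0<..}. hausdorff_premeasure s \<delta> E)"

definition hausdorff_dim :: "'a::metric_space set \<Rightarrow> ereal" where
  "hausdorff_dim E = (INF s\<in>{s. 0 < s \<and> hausdorff_measure s E = 0}. ereal s)"


text \<open>The logarithm with \<open>log 0 = - \<infinity>\<close>.\<close>

definition elog :: "real \<Rightarrow> ereal" where
  "elog x = (if x \<le> 0 then - \<infinity> else ereal (ln x))"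

definition grid_cube :: "real \<Rightarrow> ('n \<Rightarrow> int) \<Rightarrow> (real^'n) set" where
  "grid_cube r k = {x. \<forall>i. of_int (k i) * r \<le> x $ i \<and> x $ i < of_int (k i + 1) * r}"

text \<open>For a probability measure and \<open>r > 0\<close> the set below is finite, so \<^const>\<open>card\<close> is the
  true number of cubes.\<close>

definition cube_count :: "(real^'n) measure \<Rightarrow> real \<Rightarrow> real \<Rightarrow> nat" where
  "cube_count \<mu> s r = card {Q \<in> range (grid_cube r). measure \<mu> Q \<ge> r powr s}"

definition upper_coarse_spectrum :: "(real^'n) measure \<Rightarrow> real \<Rightarrow> ereal" where
  "upper_coarse_spectrum \<mu> s =
     Lim (at_right 0) (\<lambda>\<epsilon>.
       Limsup (at_right 0) (\<lambda>r.
         elog (real (cube_count \<mu> (s + \<epsilon>) r) - real (cube_count \<mu> (s - \<epsilon>) r)) / ereal (- ln r)))"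

text \<open>The limits in \<open>\<epsilon>\<close> in the two definitions around this text exist in \<^typ>\<open>ereal\<close>, as
  both expressions are monotone in \<open>\<epsilon>\<close>. The supremum is taken in \<^typ>\<open>ereal\<close> since it can be \<open>\<infinity>\<close> when \<open>\<mu>\<close> has unbounded support.\<close>

definition critical_s :: "(real^'n) measure \<Rightarrow> ereal" where
  "critical_s \<mu> =
     Lim (at_right 0) (\<lambda>\<epsilon>. SUP t\<in>{t. upper_coarse_spectrum \<mu> t \<ge> ereal (t - \<epsilon>)}. ereal t)"

definition lower_local_dim :: "(real^'n) measure \<Rightarrow> real^'n \<Rightarrow> ereal" where
  "lower_local_dim \<mu> x = Liminf (at_right 0) (\<lambda>r. elog (measure \<mu> (ball x r)) / ereal (ln r))"

text \<open>The library's \<^const>\<open>esssup\<close> is \<open>\<infinity>\<close> on non-measurable functions; this case does not arise,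
  since the lower local dimension of a Borel probability measure is Borel measurable.\<close>

definition upper_hausdorff_dim :: "(real^'n) measure \<Rightarrow> ereal" where
  "upper_hausdorff_dim \<mu> = esssup \<mu> (lower_local_dim \<mu>)"

definition non_atomic :: "'a measure \<Rightarrow> bool" where
  "non_atomic M \<longleftrightarrow>
     \<not> (\<exists>A\<in>sets M. emeasure M A > 0 \<and>
          (\<forall>B\<in>sets M. B \<subseteq> A \<longrightarrow> emeasure M B = 0 \<or> emeasure M (A - B) = 0))"


definition limsup_balls :: "(nat \<Rightarrow> real^'n) \<Rightarrow> real \<Rightarrow> (real^'n) set" where
  "limsup_balls x \<alpha> = (\<Inter>k\<in>{1..}. \<Union>n\<in>{k..}. ball (x n) (real n powr (- \<alpha>)))"

end

theory Submission
  imports Defs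
begin

text \<open>
  Fix a closed set \<open>A\<close> and put \<open>\<nu>(S) = \<mu>(A \<inter> S)\<close>. Write
  \<open>E\<close> for the limsup set, \<open>U k\<close> for the union of the balls with index at
  least \<open>k\<close>, and \<open>\<theta> = 1 / (\<alpha> s)\<close>. If \<open>s =
  \<infinity>\<close>, the assertions only say that \<open>E\<close> is a
  \<open>G\<^sub>\<delta>\<close>-set of dimension at least \<open>0\<close>. Otherwise both follow
  from one estimate: almost surely, for every \<open>0 < \<eta> < \<theta>\<close> and every dyadic
  cube \<open>D\<close>, each cover of \<open>E \<inter> A \<inter> D\<close> by dyadic cubes
  \<open>C\<close> satisfies \<open>\<Sum> \<nu>(C)\<^sup>\<eta> \<ge> \<nu>(D)\<^sup>\<eta>\<close>
  (\<open>AE_content_ge\<close>).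

  With \<open>A = UNIV\<close> this is the class condition, since \<open>{D}\<close> already covers
  \<open>D\<close> at the cost \<open>\<mu>(D)\<^sup>\<eta>\<close>. For the dimension, take
  \<open>t\<close> below the upper Hausdorff dimension of \<open>\<mu>\<close> and let
  \<open>A\<close> be the set of points \<open>x\<close> with \<open>\<mu>(B(x,r)) \<le>
  r\<^sup>t\<close> for all \<open>r < \<delta>\<close>. It is closed, and it has positive measure
  for some \<open>\<delta>\<close>. A small cube meeting \<open>A\<close> then has
  \<open>\<nu>(C)\<^sup>\<eta>\<close> at most a constant times the power \<open>t \<eta>\<close> of
  its diameter, so the estimate bounds Hausdorff sums of \<open>E\<close> from below and \<open>dim
  E \<ge> t \<eta>\<close> (\<open>hausdorff_measure_nonzero\<close>). The set \<open>A\<close> has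
  to be built into the estimate: the case \<open>A = UNIV\<close> alone controls
  \<open>\<mu>\<close>-sums, and cubes away from \<open>A\<close> may carry much more mass than the
  power \<open>t\<close> of their diameter.

  The number \<open>s\<close> enters through one consequence of its definition: for \<open>t >
  s\<close>, the part of the mass of a bounded region that lies in cubes of side \<open>r\<close>
  with \<open>\<nu>\<close>-mass below \<open>r\<^sup>t\<close> tends to \<open>0\<close> with
  \<open>r\<close> (\<open>measure_light_translated_cells_tendsto_0\<close>). Indeed, for some
  \<open>\<epsilon> > 0\<close> and all \<open>u \<ge> t\<close> there are at most about \<open>r
  powr (-(u - \<epsilon>))\<close> cells of mass about \<open>r\<^sup>u\<close>, and these carry
  mass of the order \<open>r\<^sup>\<epsilon>\<close>.

  Consider now about \<open>N = 2 powr (m / \<alpha>)\<close> of the random points with indices in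
  \<open>[N, 2N)\<close>. Their balls have radius at least the diameter of a cube of level
  \<open>m\<close>, so the cubes of level \<open>m\<close> that contain one of these points lie in
  \<open>U k\<close>. Keep the points in \<open>A \<inter> D\<close> whose cube has mass at least
  \<open>2 powr (-m t)\<close>; they are nearly \<open>N \<nu>(D)\<close> many. A Chernoff bound
  shows that a dyadic cube \<open>C \<subseteq> D\<close> receives at most \<open>(1 + \<epsilon>) N
  \<nu>(D) (\<nu>(C) / \<nu>(D))\<^sup>\<eta>\<close> of them, with a failure probability
  exponentially small in \<open>N 2 powr (-m t \<eta>) = 2 powr (m (1 / \<alpha> - t
  \<eta>))\<close>. This number grows exponentially in \<open>m\<close> as soon as \<open>t \<eta> <
  1 / \<alpha>\<close>, which some \<open>t > s\<close> satisfies exactly when \<open>\<eta> <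
  \<theta>\<close>; it therefore beats the exponentially many cubes \<open>C\<close>. So the sample
  is a discrete Frostman measure on \<open>D \<inter> U k\<close> (\<open>AE_spreads\<close>).

  The remaining step is deterministic (\<open>content_ge_of_spreads\<close>). Suppose that a cover
  had \<open>\<Sum> \<nu>(C)\<^sup>\<eta> < \<nu>(D)\<^sup>\<eta>\<close>. If every sample cube were
  contained in a covering cube, or had at least its own value \<open>\<nu>(Q)\<^sup>\<eta>\<close>
  spent inside it, then the covering cubes together with the sample cubes of the second kind would
  cover the whole sample too cheaply for a Frostman measure. So some sample cube has the same
  deficit as \<open>D\<close>, its closure lies in \<open>D\<close>, and it lies in \<open>U
  k\<close>. Iterating over \<open>k\<close> gives nested cubes shrinking to a point of \<open>E
  \<inter> A \<inter> D\<close> that is not covered.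
\<close>

section \<open>Dyadic cubes as level sets of an index map\<close>

text \<open>The cubes of side \<open>r\<close> of the grid through \<open>P\<close>, as fibres of the map that sends a point to the
  integer vector of its cell. Both the dyadic cubes and the grid cubes of the coarse spectrum are of
  this form, and disjointness and nesting become statements about integers.\<close>
definition cell :: "real \<Rightarrow> real^'n \<Rightarrow> ('n \<Rightarrow> int) \<Rightarrow> (real^'n) set" where
  "cell r P k = {x. \<forall>i. \<lfloor>(x $ i - P $ i) / r\<rfloor> = k i}"

abbreviation index :: "real \<Rightarrow> real^'n \<Rightarrow> real^'n \<Rightarrow> 'n \<Rightarrow> int" where
  "index r P x \<equiv> (\<lambda>i. \<lfloor>(x $ i - P $ i) / r\<rfloor>)"

lemma floor_quotient_iff:
  fixes y r :: real and j :: int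
  assumes "r > 0"
  shows "\<lfloor>y / r\<rfloor> = j \<longleftrightarrow> of_int j * r \<le> y \<and> y < of_int (j + 1) * r"
  using assms by (simp add: floor_eq_iff pos_le_divide_eq pos_divide_less_eq)

lemma dyadic_cube_eq_cell: "dyadic_cube P n k = cell (2 powi (-n)) P k"
  unfolding dyadic_cube_def cell_def
  by (subst floor_quotient_iff) (auto simp: algebra_simps)

lemma grid_cube_eq_cell: "r > 0 \<Longrightarrow> grid_cube r k = cell r 0 k"
  unfolding grid_cube_def cell_def by (subst floor_quotient_iff) auto

lemma mem_cell_index: "x \<in> cell r P (index r P x)"
  by (simp add: cell_def)

lemma mem_cell_iff: "x \<in> cell r P k \<longleftrightarrow> k = index r P x"
  by (auto simp: cell_def)

lemma disjoint_family_cell: "disjoint_family (cell r P)"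
  by (auto simp: disjoint_family_on_def mem_cell_iff)

lemma cell_coord_diff:
  assumes "r > 0" "x \<in> cell r P k" "y \<in> cell r P k"
  shows "\<bar>x $ i - y $ i\<bar> < r"
proof -
  have "of_int (k i) * r \<le> x $ i - P $ i \<and> x $ i - P $ i < of_int (k i + 1) * r"
    "of_int (k i) * r \<le> y $ i - P $ i \<and> y $ i - P $ i < of_int (k i + 1) * r"
    using assms floor_quotient_iff[of r] unfolding cell_def by blast+
  then show ?thesis by (auto simp: algebra_simps)
qed

lemma dist_le_coord_bound:
  fixes x y :: "real^'n"
  assumes "\<And>i. \<bar>x $ i - y $ i\<bar> < r"
  shows "dist x y < real CARD('n) * r"
proof -
  have "dist x y \<le> (\<Sum>i\<in>UNIV. \<bar>(x - y) $ i\<bar>)"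
    unfolding dist_norm by (rule norm_le_l1_cart)
  also have "\<dots> < (\<Sum>i\<in>(UNIV::'n set). r)"
    by (rule sum_strict_mono) (use assms in auto)
  finally show ?thesis by simp
qed

lemma cell_dist:
  fixes x y :: "real^'n"
  assumes "r > 0" "x \<in> cell r P k" "y \<in> cell r P k"
  shows "dist x y < real CARD('n) * r"
  using dist_le_coord_bound cell_coord_diff[OF assms] by blast

lemma cell_borel [measurable]: "cell r P k \<in> sets borel"
proof -
  have "cell r P k = (\<Inter>i\<in>UNIV. {x \<in> space borel. \<lfloor>(x $ i - P $ i) / r\<rfloor> = k i})"
    by (auto simp: cell_def)
  also have "\<dots> \<in> sets borel" by measurable
  finally show ?thesis .
qed

lemma bounded_cell:
  fixes P :: "real^'n"
  assumes "r > 0" shows "bounded (cell r P k)"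
proof (cases "cell r P k = {}")
  case False
  then obtain x where "x \<in> cell r P k" by auto
  then show ?thesis
    using cell_dist[OF assms, of x P k] unfolding bounded_def by (meson less_imp_le)
qed auto

lemma cell_nonempty:
  assumes "r > 0" shows "cell r P k \<noteq> {}"
proof -
  have "(\<chi> i. P $ i + of_int (k i) * r) \<in> cell r P k"
    using assms by (simp add: cell_def)
  then show ?thesis by blast
qed

lemma dyadic_cubes_ofE:
  assumes "C \<in> dyadic_cubes_of P n"
  obtains k where "C = cell (2 powi (-n)) P k"
  using assms by (auto simp: dyadic_cubes_of_def dyadic_cube_eq_cell)

lemma cell_in_dyadic_cubes_of: "cell (2 powi (-n)) P k \<in> dyadic_cubes_of P n"
  by (auto simp: dyadic_cubes_of_def dyadic_cube_eq_cell)

lemma dyadic_cubes_of_subset: "dyadic_cubes_of P n \<subseteq> dyadic_cubes P"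
  by (auto simp: dyadic_cubes_def)

lemma dyadic_cubesE:
  assumes "C \<in> dyadic_cubes P"
  obtains n where "C \<in> dyadic_cubes_of P n"
  using assms by (auto simp: dyadic_cubes_def)

lemma countable_dyadic_cubes_of: "countable (dyadic_cubes_of P n)"
  by (simp add: dyadic_cubes_of_def)

lemma countable_dyadic_cubes: "countable (dyadic_cubes P)"
  by (auto simp: dyadic_cubes_def intro!: countable_UN countable_dyadic_cubes_of)

lemma dyadic_cube_borel: "C \<in> dyadic_cubes P \<Longrightarrow> C \<in> sets borel"
  by (metis dyadic_cubesE dyadic_cubes_ofE cell_borel)

lemma dyadic_cube_nonempty: "C \<in> dyadic_cubes P \<Longrightarrow> C \<noteq> {}"
  by (metis dyadic_cubesE dyadic_cubes_ofE cell_nonempty zero_less_power_int zero_less_numeral)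

lemma dyadic_cube_bounded: "C \<in> dyadic_cubes P \<Longrightarrow> bounded C"
  by (metis dyadic_cubesE dyadic_cubes_ofE bounded_cell zero_less_power_int zero_less_numeral)

text \<open>The coarse index is the integer quotient of the fine one, so a finer cube cannot straddle the
  boundary of a coarser one.\<close>

lemma index_coarsen:
  assumes "n \<le> m"
  shows "index (2 powi (-n)) P x i = index (2 powi (-m)) P x i div 2 ^ nat (m - n)"
proof -
  define y where "y = x $ i - P $ i"
  have "(2::real) powi (m - n) = 2 ^ nat (m - n)"
    using assms by (simp add: power_int_def)
  moreover have "(2::real) powi (m - n) = 2 powi (-n) / 2 powi (-m)"
    by (simp flip: power_int_diff)
  ultimately have "y / 2 powi (-n) = y / 2 powi (-m) / real_of_int (2 ^ nat (m - n))"
    by (simp add: field_simps)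
  then show ?thesis
    unfolding y_def[symmetric] by (metis floor_divide_real_eq_div zero_le_numeral zero_le_power)
qed

lemma dyadic_cube_nested:
  assumes "C \<in> dyadic_cubes_of P n" "D \<in> dyadic_cubes_of P m" "n \<le> m" "C \<inter> D \<noteq> {}"
  shows "D \<subseteq> C"
proof
  fix y assume "y \<in> D"
  obtain k j where C: "C = cell (2 powi (-n)) P k" and D: "D = cell (2 powi (-m)) P j"
    using assms dyadic_cubes_ofE by metis
  obtain x where x: "x \<in> C" "x \<in> D" using assms by blast
  have "index (2 powi (-m)) P x = index (2 powi (-m)) P y"
    using x \<open>y \<in> D\<close> unfolding D mem_cell_iff by simp
  then have "index (2 powi (-n)) P x = index (2 powi (-n)) P y"
    by (intro ext) (simp only: index_coarsen[OF \<open>n \<le> m\<close>] fun_eq_iff)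
  then show "y \<in> C" using x unfolding C mem_cell_iff by simp
qed

lemma dyadic_cubes_comparable:
  assumes "C \<in> dyadic_cubes P" "D \<in> dyadic_cubes P" "C \<inter> D \<noteq> {}"
  shows "C \<subseteq> D \<or> D \<subseteq> C"
  using assms dyadic_cube_nested by (metis dyadic_cubesE inf_commute linear)

lemma dyadic_cubes_same_level:
  assumes "C \<in> dyadic_cubes_of P n" "D \<in> dyadic_cubes_of P n" "C \<inter> D \<noteq> {}"
  shows "C = D"
  using assms dyadic_cube_nested by (metis inf_commute order_antisym order_refl)

text \<open>A cube of the same or a larger size would have to be all of \<open>D\<close> and hence closed, but half-open
  cubes miss their upper corner.\<close>
lemma closure_dyadic_cube_subset_imp_finer:
  assumes "C \<in> dyadic_cubes_of P n" "D \<in> dyadic_cubes_of P m" "closure C \<subseteq> D"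
  shows "m < n"
proof (rule ccontr)
  assume "\<not> m < n"
  obtain k where k: "C = cell (2 powi (-n)) P k" using assms dyadic_cubes_ofE by metis
  have ne: "C \<noteq> {}" using k cell_nonempty by (metis zero_less_power_int zero_less_numeral)
  have "C \<subseteq> D" using assms closure_subset by blast
  with ne have "D \<subseteq> C" using dyadic_cube_nested[OF assms(1,2)] \<open>\<not> m < n\<close> by auto
  then have "closed C"
    using assms closure_subset by (metis closure_closed closure_subset_eq order_trans)
  define r :: real where "r = 2 powi (-n)"
  have r: "r > 0" by (simp add: r_def)
  define x where "x = (\<chi> i. P $ i + (of_int (k i) + 1) * r)"
  define y where "y = (\<lambda>j. \<chi> i. P $ i + (of_int (k i) + 1) * r - r / real (Suc j))"
  have "y j \<in> C" for j
    using r unfolding k r_def[symmetric] y_def cell_def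
    by (simp add: floor_eq_iff field_simps)
  moreover have "y \<longlonglongrightarrow> x"
  proof (rule vec_tendstoI)
    fix i
    have "(\<lambda>j. (P $ i + (of_int (k i) + 1) * r) - r * inverse (real (Suc j))) \<longlonglongrightarrow> (P $ i + (of_int (k i) + 1) * r) - r * 0"
      by (intro tendsto_intros LIMSEQ_inverse_real_of_nat)
    then show "(\<lambda>j. y j $ i) \<longlonglongrightarrow> x $ i" by (simp add: x_def y_def divide_inverse)
  qed
  ultimately have "x \<in> C" using \<open>closed C\<close> closed_sequentially by blast
  then show False using r unfolding k r_def[symmetric] x_def cell_def by (simp add: floor_eq_iff)
qed

lemma index_measurable: "index r P \<in> (borel :: (real^'n) measure) \<rightarrow>\<^sub>M count_space UNIV"
proof -
  have "(index r P -` {k}) = cell r P k" for k by (auto simp: cell_def fun_eq_iff)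
  then show ?thesis by (subst measurable_count_space_eq_countable) auto
qed

lemma sets_Collect_index: "{x. Q (index r P x)} \<in> sets (borel :: (real^'n) measure)"
proof -
  have "index r P -` Collect Q \<inter> space borel \<in> sets (borel :: (real^'n) measure)"
    by (rule measurable_sets[OF index_measurable]) simp
  then show ?thesis by (simp add: vimage_def)
qed

lemma side_eq: "2 powi (- int m) = (1 / 2 :: real) ^ m"
  by (simp add: power_int_minus field_simps)

lemma filterlim_side: "filterlim (\<lambda>m. 2 powi (- int m) :: real) (at_right 0) sequentially"
proof -
  have "(\<lambda>m. (1 / 2 :: real) ^ m) \<longlonglongrightarrow> 0" by (rule LIMSEQ_power_zero) simp
  then show ?thesis
    unfolding filterlim_at side_eq by (auto intro!: always_eventually)
qed

lemma side_powr: "(2 powi (- int m)) powr t = 2 powr (- (real m * t))"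
proof -
  have "2 powi (- int m) = (2::real) powr (- real m)"
    by (simp add: powr_minus powr_realpow power_int_minus)
  then show ?thesis by (simp add: powr_powr)
qed

section \<open>Mass in cells of small measure\<close>

text \<open>Turns the limits in the definitions of the coarse spectrum and of \<open>critical_s\<close> into infima,
  from which strict upper bounds can be read off.\<close>
lemma Lim_at_right_0_mono:
  fixes f :: "real \<Rightarrow> ereal"
  assumes mono: "\<And>a b. 0 < a \<Longrightarrow> a \<le> b \<Longrightarrow> f a \<le> f b"
  shows "Lim (at_right 0) f = (INF e\<in>{0<..}. f e)"
proof (rule tendsto_Lim)
  show "(f \<longlongrightarrow> (INF e\<in>{0<..}. f e)) (at_right 0)"
  proof (rule order_tendstoI)
    fix a assume "a < (INF e\<in>{0<..}. f e)"
    then have "a < f e" if "0 < e" for e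
      using that by (meson INF_lower greaterThan_iff less_le_trans)
    then show "\<forall>\<^sub>F e in at_right 0. a < f e"
      by (intro eventually_at_rightI[of 0 1]) auto
  next
    fix a assume "(INF e\<in>{0<..}. f e) < a"
    then obtain e0 where "0 < e0" "f e0 < a" by (auto simp: INF_less_iff)
    then show "\<forall>\<^sub>F e in at_right 0. f e < a"
      using mono[of _ e0] by (intro eventually_at_rightI[of 0 e0]) (auto intro: le_less_trans[of _ "f e0"])
  qed
qed (simp add: trivial_limit_at_right_real)

lemma finite_measure_heavy_finite:
  assumes M: "finite_measure M" and F: "disjoint_family F" "\<And>i. F i \<in> sets M"
    and \<delta>: "\<delta> > 0"
  shows "finite {i. \<delta> \<le> measure M (F i)}" (is "finite ?I")
    and "real (card {i. \<delta> \<le> measure M (F i)}) * \<delta> \<le> measure M (space M)"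
proof -
  interpret finite_measure M by fact
  have bd: "real (card G) * \<delta> \<le> measure M (space M)" if G: "G \<subseteq> ?I" "finite G" for G
  proof -
    have "real (card G) * \<delta> = (\<Sum>i\<in>G. \<delta>)" by simp
    also have "\<dots> \<le> (\<Sum>i\<in>G. measure M (F i))" using G by (intro sum_mono) auto
    also have "\<dots> = measure M (\<Union>i\<in>G. F i)"
      using G F by (intro finite_measure_finite_Union[symmetric])
        (auto simp: disjoint_family_on_def)
    also have "\<dots> \<le> measure M (space M)" using F(2) sets.sets_into_space by (intro bounded_measure)
    finally show ?thesis .
  qed
  have "finite ?I \<and> card ?I \<le> nat \<lfloor>measure M (space M) / \<delta>\<rfloor>"
  proof (rule finite_if_finite_subsets_card_bdd)
    fix G assume "G \<subseteq> ?I" "finite G"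
    from bd[OF this] have "real (card G) \<le> measure M (space M) / \<delta>"
      using \<delta> by (simp add: pos_le_divide_eq)
    then show "card G \<le> nat \<lfloor>measure M (space M) / \<delta>\<rfloor>" by (simp add: le_nat_floor)
  qed
  then show "finite ?I" by simp
  then show "real (card ?I) * \<delta> \<le> measure M (space M)" using bd by simp
qed

lemma inj_cell: "r > 0 \<Longrightarrow> inj (cell r P)"
  using cell_nonempty by (fastforce simp: inj_def mem_cell_iff)

lemma cube_count_eq:
  assumes "r > 0"
  shows "cube_count \<mu> s r = card {k. r powr s \<le> measure \<mu> (cell r 0 k)}"
proof -
  have "{Q \<in> range (grid_cube r). r powr s \<le> measure \<mu> Q} = cell r 0 ` {k. r powr s \<le> measure \<mu> (cell r 0 k)}"
    using grid_cube_eq_cell[OF assms] by auto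
  then show ?thesis
    unfolding cube_count_def by (simp add: card_image inj_on_subset[OF inj_cell[OF assms]])
qed

definition cell_mass :: "(real^'n) measure \<Rightarrow> real \<Rightarrow> real^'n \<Rightarrow> real" where
  "cell_mass \<mu> r x = measure \<mu> (cell r 0 (index r 0 x))"

locale borel_prob = prob_space \<mu> for \<mu> :: "(real^'n) measure" +
  assumes sets_eq [measurable_cong]: "sets \<mu> = sets borel"
begin

lemma space_eq [simp]: "space \<mu> = UNIV"
  using sets_eq_imp_space_eq[OF sets_eq] by simp

lemma measure_le_card_cells:
  assumes K: "finite K" "\<And>k. k \<in> K \<Longrightarrow> measure \<mu> (A \<inter> cell r P k) \<le> c" and A: "A \<in> sets borel"
    and S: "S \<subseteq> (\<Union>k\<in>K. A \<inter> cell r P k)"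
  shows "measure \<mu> S \<le> real (card K) * c"
proof -
  have m: "A \<inter> cell r P k \<in> sets \<mu>" for k using A by (simp add: sets_eq)
  have "measure \<mu> S \<le> measure \<mu> (\<Union>k\<in>K. A \<inter> cell r P k)"
    using K(1) m by (intro finite_measure_mono S sets.finite_UN)
  also have "\<dots> \<le> (\<Sum>k\<in>K. measure \<mu> (A \<inter> cell r P k))"
    using K m by (intro finite_measure_subadditive_finite) auto
  also have "\<dots> \<le> (\<Sum>k\<in>K. c)" using K by (intro sum_mono)
  finally show ?thesis by simp
qed

lemma heavy_cells:
  assumes "\<delta> > 0" "A \<in> sets borel"
  shows "finite {k. \<delta> \<le> measure \<mu> (A \<inter> cell r P k)}"
    and "real (card {k. \<delta> \<le> measure \<mu> (A \<inter> cell r P k)}) * \<delta> \<le> 1"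
proof -
  have "disjoint_family (\<lambda>k. A \<inter> cell r P k)"
    using disjoint_family_cell[of r P] by (auto simp: disjoint_family_on_def)
  moreover have "A \<inter> cell r P k \<in> sets \<mu>" for k using assms by (simp add: sets_eq)
  ultimately show "finite {k. \<delta> \<le> measure \<mu> (A \<inter> cell r P k)}"
    and "real (card {k. \<delta> \<le> measure \<mu> (A \<inter> cell r P k)}) * \<delta> \<le> 1"
    using finite_measure_heavy_finite[OF finite_measure_axioms _ _ assms(1)] prob_space by metis+
qed

lemma heavy_cells_UNIV:
  assumes "\<delta> > 0"
  shows "finite {k. \<delta> \<le> measure \<mu> (cell r P k)}"
    and "real (card {k. \<delta> \<le> measure \<mu> (cell r P k)}) * \<delta> \<le> 1"
  using heavy_cells[OF assms, of UNIV r P] by auto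

lemma cube_count_mono:
  assumes "0 < r" "r < 1" "s \<le> s'"
  shows "cube_count \<mu> s r \<le> cube_count \<mu> s' r"
proof -
  have "r powr s' \<le> r powr s" using assms by (intro powr_mono') auto
  then show ?thesis
    unfolding cube_count_eq[OF assms(1)]
    using heavy_cells_UNIV[of "r powr s'" r 0] assms by (intro card_mono) auto
qed

lemma cube_count_diff:
  assumes "0 < r" "r < 1" "s \<le> s'"
  shows "real (cube_count \<mu> s' r) - real (cube_count \<mu> s r)
    = real (card {k. r powr s' \<le> measure \<mu> (cell r 0 k) \<and> measure \<mu> (cell r 0 k) < r powr s})"
proof -
  have le: "r powr s' \<le> r powr s" using assms by (intro powr_mono') auto
  have "{k. r powr s' \<le> measure \<mu> (cell r 0 k) \<and> measure \<mu> (cell r 0 k) < r powr s}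
     = {k. r powr s' \<le> measure \<mu> (cell r 0 k)} - {k. r powr s \<le> measure \<mu> (cell r 0 k)}" by auto
  moreover have sub: "{k. r powr s \<le> measure \<mu> (cell r 0 k)} \<subseteq> {k. r powr s' \<le> measure \<mu> (cell r 0 k)}"
    using le by auto
  ultimately have "card {k. r powr s' \<le> measure \<mu> (cell r 0 k) \<and> measure \<mu> (cell r 0 k) < r powr s}
     = cube_count \<mu> s' r - cube_count \<mu> s r"
    unfolding cube_count_eq[OF assms(1)]
    using card_Diff_subset[OF heavy_cells_UNIV(1)[of "r powr s" r 0] sub] assms(1) by simp
  then show ?thesis using cube_count_mono[OF assms] by (simp add: of_nat_diff)
qed

lemma elog_mono: "x \<le> y \<Longrightarrow> elog x \<le> elog y"
  by (auto simp: elog_def)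

lemma upper_coarse_spectrum_lessE:
  assumes "upper_coarse_spectrum \<mu> t < ereal c" "e0 > 0"
  obtains e where "0 < e" "e \<le> e0"
    "\<forall>\<^sub>F r in at_right 0. real (cube_count \<mu> (t + e) r) - real (cube_count \<mu> (t - e) r) \<le> r powr (-c)"
proof -
  define h where "h = (\<lambda>e. Limsup (at_right 0) (\<lambda>r.
         elog (real (cube_count \<mu> (t + e) r) - real (cube_count \<mu> (t - e) r)) / ereal (- ln r)))"
  have ev: "\<forall>\<^sub>F r :: real in at_right 0. 0 < r \<and> r < 1"
    by (intro eventually_at_rightI[of 0 1]) auto
  have mono: "h a \<le> h b" if "0 < a" "a \<le> b" for a b
    unfolding h_def
  proof (rule Limsup_mono, rule eventually_mono[OF ev])
    fix r :: real assume r: "0 < r \<and> r < 1"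
    have "elog (real (cube_count \<mu> (t + a) r) - real (cube_count \<mu> (t - a) r))
       \<le> elog (real (cube_count \<mu> (t + b) r) - real (cube_count \<mu> (t - b) r))"
      using cube_count_mono[of r "t + a" "t + b"] cube_count_mono[of r "t - b" "t - a"] r that
      by (intro elog_mono) simp
    then show "elog (real (cube_count \<mu> (t + a) r) - real (cube_count \<mu> (t - a) r)) / ereal (- ln r)
       \<le> elog (real (cube_count \<mu> (t + b) r) - real (cube_count \<mu> (t - b) r)) / ereal (- ln r)"
      using r by (intro ereal_divide_right_mono) auto
  qed
  have "(INF e\<in>{0<..}. h e) < ereal c"
    using assms(1) Lim_at_right_0_mono[of h, OF mono] unfolding upper_coarse_spectrum_def h_def by simp
  then obtain e1 where e1: "0 < e1" "h e1 < ereal c" by (auto simp: INF_less_iff)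
  define e where "e = min e1 e0"
  have e: "0 < e" "e \<le> e0" "h e < ereal c"
    using e1 assms(2) mono[of e e1] by (auto simp: e_def intro: le_less_trans)
  have "\<forall>\<^sub>F r in at_right 0.
     elog (real (cube_count \<mu> (t + e) r) - real (cube_count \<mu> (t - e) r)) / ereal (- ln r) < ereal c"
    using e(3) unfolding h_def by (rule Limsup_lessD)
  with ev have "\<forall>\<^sub>F r in at_right 0. real (cube_count \<mu> (t + e) r) - real (cube_count \<mu> (t - e) r) \<le> r powr (-c)"
  proof eventually_elim
    case (elim r)
    define N where "N = real (cube_count \<mu> (t + e) r) - real (cube_count \<mu> (t - e) r)"
    show ?case
    proof (cases "N \<le> 0")
      case True
      then show ?thesis unfolding N_def[symmetric] by (rule order_trans) simp
    next
      case False
      have "ln r < 0" using elim by simp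
      have "elog N / ereal (- ln r) = ereal (ln N / (- ln r))"
        using False \<open>ln r < 0\<close> by (simp add: elog_def)
      then have "ln N / (- ln r) < c" using elim(2) unfolding N_def[symmetric] by simp
      then have "ln N < c * (- ln r)" using \<open>ln r < 0\<close> by (subst (asm) pos_divide_less_eq) auto
      then have "ln N < - c * ln r" by simp
      then have "N < exp (- c * ln r)" using False by (metis exp_less_mono exp_ln not_le)
      then show ?thesis unfolding N_def[symmetric] powr_def using elim by simp
    qed
  qed
  with e show ?thesis using that by blast
qed

lemma critical_s_lessE:
  assumes "critical_s \<mu> < ereal t0"
  obtains e where "0 < e" "\<And>t. t0 \<le> t \<Longrightarrow> upper_coarse_spectrum \<mu> t < ereal (t - e)"
proof -
  define f where "f = (\<lambda>\<epsilon>. SUP t\<in>{t. upper_coarse_spectrum \<mu> t \<ge> ereal (t - \<epsilon>)}. ereal t)"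
  have mono: "f a \<le> f b" if "0 < a" "a \<le> b" for a b
  proof -
    have "{t. upper_coarse_spectrum \<mu> t \<ge> ereal (t - a)} \<subseteq> {t. upper_coarse_spectrum \<mu> t \<ge> ereal (t - b)}"
      using that by (auto intro: order_trans[rotated])
    then show ?thesis unfolding f_def by (rule SUP_subset_mono) simp
  qed
  have "(INF e\<in>{0<..}. f e) < ereal t0"
    using assms Lim_at_right_0_mono[of f, OF mono] unfolding critical_s_def f_def by simp
  then obtain e where e: "0 < e" "f e < ereal t0" by (auto simp: INF_less_iff)
  have "upper_coarse_spectrum \<mu> t < ereal (t - e)" if "t0 \<le> t" for t
  proof (rule ccontr)
    assume "\<not> ?thesis"
    then have "ereal t \<le> f e" unfolding f_def by (intro SUP_upper) (auto simp: not_less)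
    also note e(2)
    finally show False using that by simp
  qed
  with e that show ?thesis by blast
qed

definition band :: "real \<Rightarrow> real \<Rightarrow> real \<Rightarrow> (real^'n) set" where
  "band r a b = {x. r powr b \<le> cell_mass \<mu> r x \<and> cell_mass \<mu> r x < r powr a}"

lemma cell_mass_measurable [measurable]: "cell_mass \<mu> r \<in> borel_measurable borel"
proof -
  have "(\<lambda>k. measure \<mu> (cell r 0 k)) \<circ> index r 0 \<in> (borel :: (real^'n) measure) \<rightarrow>\<^sub>M borel"
    using index_measurable[where P = "0 :: real^'n" and r = r] by (rule measurable_comp) simp
  then show ?thesis unfolding cell_mass_def[abs_def] comp_def .
qed

lemma band_measurable [measurable]: "band r a b \<in> sets borel"
  unfolding band_def by measurable

text \<open>On a short interval of exponents around \<open>t\<close>, at most \<open>r powr (-(t - e0))\<close> cells of mass less than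
  \<open>r powr (t - e)\<close> have total mass at most \<open>r powr (e0 - e)\<close>. The property is additive in
  the interval of exponents, so bisection extends it from short intervals to \<open>[t0, T]\<close>.\<close>
lemma measure_band_tendsto_0:
  assumes "critical_s \<mu> < ereal t0" "t0 \<le> T"
  shows "((\<lambda>r. measure \<mu> (band r t0 T)) \<longlongrightarrow> 0) (at_right 0)"
proof -
  have ev: "\<forall>\<^sub>F r :: real in at_right 0. 0 < r \<and> r < 1"
    by (intro eventually_at_rightI[of 0 1]) auto
  show ?thesis
    using assms(2)
  proof (induction rule: Bolzano)
    case (trans a b c)
    have "((\<lambda>r. measure \<mu> (band r a b) + measure \<mu> (band r b c)) \<longlongrightarrow> 0 + 0) (at_right 0)"
      by (intro tendsto_add trans)
    moreover have "measure \<mu> (band r a c) \<le> measure \<mu> (band r a b) + measure \<mu> (band r b c)" for r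
    proof -
      have "measure \<mu> (band r a c) \<le> measure \<mu> (band r a b \<union> band r b c)"
        by (intro finite_measure_mono) (auto simp: band_def sets_eq)
      also have "\<dots> \<le> measure \<mu> (band r a b) + measure \<mu> (band r b c)"
        by (intro measure_Un_le) (auto simp: sets_eq)
      finally show ?thesis .
    qed
    ultimately show ?case
      using tendsto_sandwich[OF always_eventually always_eventually tendsto_const, of 0
          "\<lambda>r. measure \<mu> (band r a c)" "\<lambda>r. measure \<mu> (band r a b) + measure \<mu> (band r b c)"]
      by simp
  next
    case (local t)
    obtain e0 where e0: "0 < e0" "\<And>t. t0 \<le> t \<Longrightarrow> upper_coarse_spectrum \<mu> t < ereal (t - e0)"
      using critical_s_lessE[OF assms(1)] by blast
    obtain e where e: "0 < e" "e \<le> e0 / 2"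
      "\<forall>\<^sub>F r in at_right 0. real (cube_count \<mu> (t + e) r) - real (cube_count \<mu> (t - e) r) \<le> r powr (-(t - e0))"
      using upper_coarse_spectrum_lessE[OF e0(2)[OF local(1)], of "e0 / 2"] e0(1) by auto
    have "((\<lambda>r. measure \<mu> (band r a b)) \<longlongrightarrow> 0) (at_right 0)" if ab: "a \<le> t" "t \<le> b" "b - a < e" for a b
    proof (rule tendsto_sandwich[of "\<lambda>_. 0" _ _ "\<lambda>r. r powr (e0 - e)"])
      show "((\<lambda>r. r powr (e0 - e)) \<longlongrightarrow> 0) (at_right 0)"
      proof -
        have "((\<lambda>r::real. r powr (e0 - e)) \<longlongrightarrow> 0 powr (e0 - e)) (at_right 0)"
          using e e0 by (intro tendsto_powr' tendsto_intros) (auto simp: eventually_at_right_less intro: eventually_mono[OF ev])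
        then show ?thesis by simp
      qed
      show "\<forall>\<^sub>F r in at_right 0. measure \<mu> (band r a b) \<le> r powr (e0 - e)"
        using ev e(3)
      proof eventually_elim
        case (elim r)
        then have r: "0 < r" "r < 1" by auto
        define K where "K = {k. r powr (t + e) \<le> measure \<mu> (cell r 0 k) \<and> measure \<mu> (cell r 0 k) < r powr (t - e)}"
        have "r powr (t + e) \<le> r powr b" "r powr a \<le> r powr (t - e)"
          using r ab e by (auto intro!: powr_mono')
        then have sub: "band r a b \<subseteq> (\<Union>k\<in>K. UNIV \<inter> cell r 0 k)"
        proof (intro subsetI)
          fix x assume "x \<in> band r a b"
          with \<open>r powr (t + e) \<le> r powr b\<close> \<open>r powr a \<le> r powr (t - e)\<close> have "index r 0 x \<in> K"
            unfolding band_def K_def cell_mass_def by simp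
          then show "x \<in> (\<Union>k\<in>K. UNIV \<inter> cell r 0 k)" using mem_cell_index[of x r 0] by blast
        qed
        have "measure \<mu> (band r a b) \<le> real (card K) * r powr (t - e)"
          by (rule measure_le_card_cells[OF _ _ _ sub])
             (use finite_subset[OF _ heavy_cells_UNIV(1)[of "r powr (t + e)" r 0], of K] r in
              \<open>auto simp: K_def\<close>)
        also have "real (card K) \<le> r powr (-(t - e0))"
          using elim(2) cube_count_diff[OF r, of "t - e" "t + e"] e by (simp add: K_def)
        then have "real (card K) * r powr (t - e) \<le> r powr (-(t - e0)) * r powr (t - e)"
          by (intro mult_right_mono) auto
        also have "\<dots> = r powr (e0 - e)" by (simp flip: powr_add)
        finally show ?case .
      qed
    qed auto
    then show ?case using e(1) by blast
  qed
qed

text \<open>Cells of mass below \<open>r powr T\<close> with \<open>T\<close> larger than the dimension are too few, within a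
  bounded region, to carry mass.\<close>

lemma measure_tiny_cells_tendsto_0:
  fixes D :: "(real^'n) set"
  assumes D: "bounded D" "D \<in> sets borel" and T: "real CARD('n) < T"
  shows "((\<lambda>r. measure \<mu> {x\<in>D. cell_mass \<mu> r x < r powr T}) \<longlongrightarrow> 0) (at_right 0)"
proof -
  have ev: "\<forall>\<^sub>F r :: real in at_right 0. 0 < r \<and> r < 1"
    by (intro eventually_at_rightI[of 0 1]) auto
  obtain B where B: "\<And>x. x \<in> D \<Longrightarrow> norm x \<le> B" "B > 0"
    using D(1) by (auto simp: bounded_pos)
  define c where "c = (2 * B + 5) ^ CARD('n)"
  have "((\<lambda>r::real. r powr (T - CARD('n))) \<longlongrightarrow> 0 powr (T - CARD('n))) (at_right 0)"
    using T by (intro tendsto_powr' tendsto_intros) (auto intro: eventually_mono[OF ev])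
  then have lim: "((\<lambda>r. c * r powr (T - CARD('n))) \<longlongrightarrow> 0) (at_right 0)"
    using tendsto_mult[OF tendsto_const] by fastforce
  have bd: "\<forall>\<^sub>F r in at_right 0. measure \<mu> {x\<in>D. cell_mass \<mu> r x < r powr T} \<le> c * r powr (T - CARD('n))"
    using ev
  proof eventually_elim
    case (elim r)
    then have r: "0 < r" "r < 1" by auto
    define L where "L = \<lceil>B / r\<rceil> + 1"
    define K where "K = {k \<in> PiE UNIV (\<lambda>_::'n. {-L..L}). measure \<mu> (cell r 0 k) < r powr T}"
    have "0 \<le> B / r" using r B(2) by simp
    then have L0: "L \<ge> 0" unfolding L_def by linarith
    have "finite (PiE UNIV (\<lambda>_::'n. {-L..L}))" by (intro finite_PiE) auto
    then have finK: "finite K" by (simp add: K_def)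
    have "card K \<le> card (PiE UNIV (\<lambda>_::'n. {-L..L}))"
      unfolding K_def by (intro card_mono finite_PiE) auto
    also have "\<dots> = nat (2 * L + 1) ^ CARD('n)" by (simp add: card_PiE)
    finally have "real (card K) \<le> real (nat (2 * L + 1)) ^ CARD('n)" by (metis of_nat_le_iff of_nat_power)
    also have "\<dots> \<le> ((2 * B + 5) / r) ^ CARD('n)"
    proof (rule power_mono)
      have "real (nat (2 * L + 1)) = 2 * of_int \<lceil>B / r\<rceil> + 3" using L0 by (simp add: L_def)
      also have "\<dots> \<le> 2 * (B / r + 1) + 3"
        by (intro add_right_mono mult_left_mono of_int_ceiling_le_add_one) simp
      also have "\<dots> \<le> (2 * B + 5) / r" using r by (simp add: field_simps)
      finally show "real (nat (2 * L + 1)) \<le> (2 * B + 5) / r" .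
    qed simp
    also have "\<dots> = c * r powr (- real CARD('n))"
      using r by (simp add: c_def power_divide powr_minus powr_realpow divide_inverse power_mult_distrib power_inverse)
    finally have cardK: "real (card K) \<le> c * r powr (- real CARD('n))" .
    have sub: "{x\<in>D. cell_mass \<mu> r x < r powr T} \<subseteq> (\<Union>k\<in>K. UNIV \<inter> cell r 0 k)"
    proof (intro subsetI)
      fix x assume x: "x \<in> {x\<in>D. cell_mass \<mu> r x < r powr T}"
      have "index r 0 x i \<in> {-L..L}" for i
      proof -
        have "\<bar>x $ i\<bar> \<le> B" using x B(1) component_le_norm_cart[of x i] by force
        then have "\<bar>x $ i / r\<bar> \<le> B / r" using r by (simp add: divide_right_mono)
        then show ?thesis unfolding L_def by (simp; linarith)
      qed
      then have "index r 0 x \<in> K" using x by (auto simp: K_def cell_mass_def)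
      then show "x \<in> (\<Union>k\<in>K. UNIV \<inter> cell r 0 k)" using mem_cell_index[of x r 0] by blast
    qed
    have "measure \<mu> {x\<in>D. cell_mass \<mu> r x < r powr T} \<le> real (card K) * r powr T"
      by (rule measure_le_card_cells[OF finK _ _ sub]) (auto simp: K_def)
    also have "\<dots> \<le> c * r powr (- real CARD('n)) * r powr T"
      using cardK by (intro mult_right_mono) auto
    also have "\<dots> = c * r powr (T - CARD('n))" by (simp flip: powr_add)
    finally show ?case .
  qed
  show ?thesis
    by (rule tendsto_sandwich[OF _ bd tendsto_const lim]) auto
qed

lemma measure_light_cells_tendsto_0:
  fixes D :: "(real^'n) set"
  assumes D: "bounded D" "D \<in> sets borel" and t: "critical_s \<mu> < ereal t"
  shows "((\<lambda>r. measure \<mu> {x\<in>D. cell_mass \<mu> r x < r powr t}) \<longlongrightarrow> 0) (at_right 0)"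
proof -
  \<comment> \<open>Above the dimension, light cells are negligible by counting; below, by the coarse spectrum.\<close>
  define T where "T = max t (real CARD('n) + 1)"
  have "((\<lambda>r. measure \<mu> (band r t T) + measure \<mu> {x\<in>D. cell_mass \<mu> r x < r powr T}) \<longlongrightarrow> 0 + 0) (at_right 0)"
    by (intro tendsto_add measure_band_tendsto_0[OF t] measure_tiny_cells_tendsto_0[OF D]) (auto simp: T_def)
  then have lim: "((\<lambda>r. measure \<mu> (band r t T) + measure \<mu> {x\<in>D. cell_mass \<mu> r x < r powr T}) \<longlongrightarrow> 0) (at_right 0)"
    by simp
  have "measure \<mu> {x\<in>D. cell_mass \<mu> r x < r powr t}
     \<le> measure \<mu> (band r t T) + measure \<mu> {x\<in>D. cell_mass \<mu> r x < r powr T}" for r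
  proof -
    have m: "{x\<in>D. cell_mass \<mu> r x < r powr s} \<in> sets \<mu>" for s
      unfolding sets_eq using D(2) by measurable
    have "measure \<mu> {x\<in>D. cell_mass \<mu> r x < r powr t}
       \<le> measure \<mu> (band r t T \<union> {x\<in>D. cell_mass \<mu> r x < r powr T})"
    proof (rule finite_measure_mono)
      show "{x\<in>D. cell_mass \<mu> r x < r powr t} \<subseteq> band r t T \<union> {x\<in>D. cell_mass \<mu> r x < r powr T}"
        by (auto simp: band_def)
      show "band r t T \<union> {x\<in>D. cell_mass \<mu> r x < r powr T} \<in> sets \<mu>"
        using band_measurable[of r t T] m[of T] unfolding sets_eq by (rule sets.Un)
    qed
    also have "\<dots> \<le> measure \<mu> (band r t T) + measure \<mu> {x\<in>D. cell_mass \<mu> r x < r powr T}"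
      using band_measurable[of r t T, folded sets_eq] m[of T] by (rule measure_Un_le)
    finally show ?thesis .
  qed
  then show ?thesis
    by (intro tendsto_sandwich[OF _ _ tendsto_const lim]) auto
qed

lemma measure_le_add_Diff:
  assumes "L \<in> sets \<mu>"
  shows "measure \<mu> S \<le> measure \<mu> L + measure \<mu> (S - L)"
proof (cases "S \<in> sets \<mu>")
  case True
  have "measure \<mu> S \<le> measure \<mu> (L \<union> (S - L))"
    using True assms by (intro finite_measure_mono) auto
  also have "\<dots> \<le> measure \<mu> L + measure \<mu> (S - L)"
    using True assms by (intro measure_Un_le) auto
  finally show ?thesis .
qed (simp add: measure_notin_sets)

text \<open>A grid cell meets at most \<open>2 ^ CARD('n)\<close> translated cells of the same side. Few grid cells are
  heavy, so few translated cells meet one of them, and the light ones among these carry little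
  mass.\<close>

lemma measure_light_translated_cells_tendsto_0:
  fixes D A :: "(real^'n) set"
  assumes D: "bounded D" "D \<in> sets borel" and A: "A \<in> sets borel"
    and t: "critical_s \<mu> < ereal t"
  shows "((\<lambda>r. measure \<mu> {x\<in>A \<inter> D. measure \<mu> (A \<inter> cell r P (index r P x)) < r powr t}) \<longlongrightarrow> 0) (at_right 0)"
proof -
  have ev: "\<forall>\<^sub>F r :: real in at_right 0. 0 < r \<and> r < 1"
    by (intro eventually_at_rightI[of 0 1]) auto
  obtain t0 where t0: "critical_s \<mu> < ereal t0" "t0 < t"
    using ereal_dense2[OF t] by auto
  define c where "c = (2::real) ^ CARD('n)"
  let ?light = "\<lambda>r. {x\<in>D. cell_mass \<mu> r x < r powr t0}"
  have "((\<lambda>r::real. r powr (t - t0)) \<longlongrightarrow> 0 powr (t - t0)) (at_right 0)"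
    using t0 by (intro tendsto_powr' tendsto_intros) (auto intro: eventually_mono[OF ev])
  then have "((\<lambda>r. measure \<mu> (?light r) + c * r powr (t - t0)) \<longlongrightarrow> 0 + c * 0) (at_right 0)"
    by (intro tendsto_add tendsto_mult tendsto_const measure_light_cells_tendsto_0[OF D t0(1)]) simp
  then have lim: "((\<lambda>r. measure \<mu> (?light r) + c * r powr (t - t0)) \<longlongrightarrow> 0) (at_right 0)"
    by simp
  have bd: "\<forall>\<^sub>F r in at_right 0. measure \<mu> {x\<in>A \<inter> D. measure \<mu> (A \<inter> cell r P (index r P x)) < r powr t}
      \<le> measure \<mu> (?light r) + c * r powr (t - t0)"
    using ev
  proof eventually_elim
    case (elim r)
    then have r: "0 < r" "r < 1" by auto
    define H where "H = {k. r powr t0 \<le> measure \<mu> (cell r 0 k)}"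
    define E where "E = PiE UNIV (\<lambda>_::'n. {0, 1::int})"
    define J where "J = {j \<in> (\<lambda>(k, e) i. k i + \<lfloor>- P $ i / r\<rfloor> + e i) ` (H \<times> E).
        measure \<mu> (A \<inter> cell r P j) < r powr t}"
    have H: "finite H" "real (card H) * r powr t0 \<le> 1"
      using heavy_cells_UNIV[of "r powr t0" r 0] r by (auto simp: H_def)
    have E: "finite E" "card E = 2 ^ CARD('n)" unfolding E_def by (auto intro: finite_PiE simp: card_PiE numeral_2_eq_2)
    have fin: "finite (H \<times> E)" using H E by auto
    then have finJ: "finite J" by (simp add: J_def)
    have "card J \<le> card ((\<lambda>(k, e) i. k i + \<lfloor>- P $ i / r\<rfloor> + e i) ` (H \<times> E))"
      unfolding J_def using fin by (intro card_mono) auto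
    also have "\<dots> \<le> card (H \<times> E)" by (rule card_image_le[OF fin])
    finally have "real (card J) \<le> real (card H * 2 ^ CARD('n))"
      using E by (simp only: of_nat_le_iff card_cartesian_product)
    then have "real (card J) \<le> real (card H) * c" by (simp add: c_def)
    also have "real (card H) \<le> r powr (- t0)"
      using H(2) r by (simp add: powr_minus field_simps)
    then have "real (card H) * c \<le> r powr (- t0) * c" by (intro mult_right_mono) (auto simp: c_def)
    finally have cardJ: "real (card J) \<le> r powr (- t0) * c" .
    let ?S = "{x\<in>A \<inter> D. measure \<mu> (A \<inter> cell r P (index r P x)) < r powr t}"
    have sub: "?S - ?light r \<subseteq> (\<Union>j\<in>J. A \<inter> cell r P j)"
    proof (intro subsetI)
      fix x assume x: "x \<in> ?S - ?light r"
      have k: "index r 0 x \<in> H" using x by (auto simp: H_def cell_mass_def)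
      define e where "e = (\<lambda>i. index r P x i - index r 0 x i - \<lfloor>- P $ i / r\<rfloor>)"
      have "e i \<in> {0, 1}" for i
      proof -
        have "(x $ i - P $ i) / r = x $ i / r + (- P $ i / r)" by (simp add: diff_divide_distrib)
        then have "e i = \<lfloor>x $ i / r + (- P $ i / r)\<rfloor> - \<lfloor>x $ i / r\<rfloor> - \<lfloor>- P $ i / r\<rfloor>"
          by (simp add: e_def)
        moreover have "0 \<le> \<lfloor>a + b\<rfloor> - \<lfloor>a\<rfloor> - \<lfloor>b\<rfloor>" "\<lfloor>a + b\<rfloor> - \<lfloor>a\<rfloor> - \<lfloor>b\<rfloor> \<le> 1" for a b :: real by linarith+
        ultimately have "0 \<le> e i" "e i \<le> 1" by metis+
        then show ?thesis by auto
      qed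
      then have "e \<in> E" by (auto simp: E_def)
      moreover have "index r P x = (\<lambda>(k, e) i. k i + \<lfloor>- P $ i / r\<rfloor> + e i) (index r 0 x, e)"
        by (simp add: e_def)
      ultimately have "index r P x \<in> J" unfolding J_def using k x by blast
      then show "x \<in> (\<Union>j\<in>J. A \<inter> cell r P j)" using mem_cell_index[of x r P] x by blast
    qed
    have "measure \<mu> (?S - ?light r) \<le> real (card J) * r powr t"
      by (rule measure_le_card_cells[OF finJ _ A sub]) (auto simp: J_def)
    also have "\<dots> \<le> (r powr (- t0) * c) * r powr t"
      using cardJ by (intro mult_right_mono) auto
    also have "\<dots> = c * r powr (t - t0)" by (simp add: algebra_simps flip: powr_add)
    finally have small: "measure \<mu> (?S - ?light r) \<le> c * r powr (t - t0)" .
    have ml: "?light r \<in> sets \<mu>" unfolding sets_eq using D(2) by measurable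
    have "measure \<mu> ?S \<le> measure \<mu> (?light r) + measure \<mu> (?S - ?light r)"
      by (rule measure_le_add_Diff[OF ml])
    with small show ?case by simp
  qed
  show ?thesis by (rule tendsto_sandwich[OF _ bd tendsto_const lim]) auto
qed

end

section \<open>Sums over arbitrary families in the extended nonnegative reals\<close>

lemma ennreal_infsum_eq_SUP:
  fixes f :: "'a \<Rightarrow> ennreal"
  shows "infsum f A = (SUP F\<in>{F. finite F \<and> F \<subseteq> A}. sum f F)"
  by (rule nonneg_infsum_complete) auto

lemma sum_le_ennreal_infsum:
  fixes f :: "'a \<Rightarrow> ennreal"
  assumes "finite F" "F \<subseteq> A"
  shows "sum f F \<le> infsum f A"
  unfolding ennreal_infsum_eq_SUP using assms by (intro SUP_upper) auto

lemma ennreal_infsum_mono_set: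
  fixes f :: "'a \<Rightarrow> ennreal"
  assumes "A \<subseteq> B" shows "infsum f A \<le> infsum f B"
  unfolding ennreal_infsum_eq_SUP using assms by (intro SUP_subset_mono) auto

lemma ennreal_summable_on: "(f :: 'a \<Rightarrow> ennreal) summable_on A"
  by (rule nonneg_summable_on_complete) auto

lemma ennreal_infsum_UN_le:
  fixes f :: "'a \<Rightarrow> ennreal"
  shows "infsum f (\<Union>U\<in>UU. F U) \<le> infsum (\<lambda>U. infsum f (F U)) UU"
  unfolding ennreal_infsum_eq_SUP[of f "\<Union>U\<in>UU. F U"]
proof (rule SUP_least, clarify)
  fix T assume T: "finite T" "T \<subseteq> (\<Union>U\<in>UU. F U)"
  then have "\<forall>C\<in>T. \<exists>U. U \<in> UU \<and> C \<in> F U" by auto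
  from bchoice[OF this] obtain u where u: "\<And>C. C \<in> T \<Longrightarrow> u C \<in> UU \<and> C \<in> F (u C)" by auto
  have "sum f T = (\<Sum>U\<in>u ` T. sum f {C\<in>T. u C = U})" by (rule sum.image_gen[OF T(1)])
  also have "\<dots> \<le> (\<Sum>U\<in>u ` T. infsum f (F U))"
  proof (intro sum_mono sum_le_ennreal_infsum)
    fix U show "{C\<in>T. u C = U} \<subseteq> F U" using u by blast
  qed (use T(1) in auto)
  also have "\<dots> \<le> infsum (\<lambda>U. infsum f (F U)) UU"
    using u T(1) by (intro sum_le_ennreal_infsum) auto
  finally show "sum f T \<le> infsum (\<lambda>U. infsum f (F U)) UU" .
qed

lemma ennreal_infsum_le:
  fixes f :: "'a \<Rightarrow> ennreal"
  assumes "\<And>G. finite G \<Longrightarrow> G \<subseteq> A \<Longrightarrow> sum f G \<le> c"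
  shows "infsum f A \<le> c"
  unfolding ennreal_infsum_eq_SUP using assms by (intro SUP_least) auto

section \<open>Covers of limsup sets by dyadic cubes\<close>

text \<open>A discrete Frostman measure of exponent \<open>\<eta>\<close> relative to \<open>\<nu>\<close>: unit masses on cubes of one level
  inside \<open>D \<inter> U\<close>, normalised by their number and by \<open>\<nu> D\<close>. The family is indexed because a cube that
  contains several sample points has to be counted several times.\<close>
definition frostman_family ::
    "real^'n \<Rightarrow> ((real^'n) set \<Rightarrow> real) \<Rightarrow> real \<Rightarrow> (real^'n) set \<Rightarrow> (real^'n) set \<Rightarrow>
     real \<Rightarrow> int \<Rightarrow> nat set \<Rightarrow> (nat \<Rightarrow> (real^'n) set) \<Rightarrow> bool" where
  "frostman_family P \<nu> \<eta> U D \<epsilon> m K q \<longleftrightarrow> finite K \<and> K \<noteq> {} \<and>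
     (\<forall>k\<in>K. q k \<in> dyadic_cubes_of P m \<and> closure (q k) \<subseteq> D \<and> q k \<subseteq> U \<and> 0 < \<nu> (q k)) \<and>
     (\<forall>C\<in>dyadic_cubes P. C \<subseteq> D \<longrightarrow>
        real (card {k\<in>K. q k \<subseteq> C}) \<le> (1 + \<epsilon>) * real (card K) * (\<nu> C / \<nu> D) powr \<eta>)"

text \<open>\<open>U\<close> carries, inside \<open>D\<close>, discrete Frostman measures with constants arbitrarily close to \<open>1\<close>. The
  sharp constant is what makes the content of \<open>E \<inter> D\<close> equal to that of \<open>D\<close>, not merely
  comparable to it.\<close>
definition spreads ::
    "real^'n \<Rightarrow> ((real^'n) set \<Rightarrow> real) \<Rightarrow> real \<Rightarrow> (real^'n) set \<Rightarrow> (real^'n) set \<Rightarrow> bool" where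
  "spreads P \<nu> \<eta> U D \<longleftrightarrow> (\<forall>\<epsilon>>0. \<exists>m K q. frostman_family P \<nu> \<eta> U D \<epsilon> m K q)"

text \<open>The mass ratio \<open>\<nu> C / \<nu> D\<close> is at most \<open>1\<close>, so smaller exponents give weaker bounds.\<close>
lemma spreads_mono:
  assumes spr: "spreads P \<nu> \<eta> U D" and le: "\<eta>' \<le> \<eta>" and D: "\<nu> D > 0"
    and nonneg: "\<And>S. 0 \<le> \<nu> S"
    and mono: "\<And>C. C \<in> dyadic_cubes P \<Longrightarrow> C \<subseteq> D \<Longrightarrow> \<nu> C \<le> \<nu> D"
  shows "spreads P \<nu> \<eta>' U D"
proof -
  have "frostman_family P \<nu> \<eta>' U D \<epsilon> m K q"
    if "\<epsilon> > 0" and F: "frostman_family P \<nu> \<eta> U D \<epsilon> m K q" for \<epsilon> m K q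
  proof -
    have "real (card {k\<in>K. q k \<subseteq> C}) \<le> (1 + \<epsilon>) * real (card K) * (\<nu> C / \<nu> D) powr \<eta>'"
      if C: "C \<in> dyadic_cubes P" "C \<subseteq> D" for C
    proof -
      have "real (card {k\<in>K. q k \<subseteq> C}) \<le> (1 + \<epsilon>) * real (card K) * (\<nu> C / \<nu> D) powr \<eta>"
        using F C unfolding frostman_family_def by blast
      also have "\<dots> \<le> (1 + \<epsilon>) * real (card K) * (\<nu> C / \<nu> D) powr \<eta>'"
        using mono[OF C] nonneg[of C] D \<open>\<epsilon> > 0\<close> le by (intro mult_left_mono powr_mono') auto
      finally show ?thesis .
    qed
    then show ?thesis using F unfolding frostman_family_def by blast
  qed
  then show ?thesis using spr unfolding spreads_def by blast
qed

text \<open>If no cube of the Frostman family were suitable, then the sample would be covered by the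
  covering cubes that contain a sample cube (\<open>T1\<close>) and the sample cubes not contained in any of them
  (\<open>T2\<close>). The value of a cube in \<open>T2\<close> is at most what is spent inside it, and these
  expenses concern different covering cubes, so this cover costs no more than the given one. That is
  too little for a Frostman family.\<close>
lemma exists_uncovered_subcube:
  assumes spr: "spreads P \<nu> \<eta> U D" and D: "D \<in> dyadic_cubes P" "\<nu> D > 0"
    and nonneg: "\<And>S. 0 \<le> \<nu> S"
    and CC: "CC \<subseteq> dyadic_cubes P" and noC: "\<And>C. C \<in> CC \<Longrightarrow> \<not> D \<subseteq> C"
    and small: "infsum (\<lambda>C. ennreal (\<nu> C powr \<eta>)) {C\<in>CC. C \<subseteq> D} < ennreal (\<nu> D powr \<eta>)"
  obtains Q where "Q \<in> dyadic_cubes P" "closure Q \<subseteq> D" "Q \<subseteq> U" "\<nu> Q > 0"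
    "\<And>C. C \<in> CC \<Longrightarrow> \<not> Q \<subseteq> C"
    "infsum (\<lambda>C. ennreal (\<nu> C powr \<eta>)) {C\<in>CC. C \<subseteq> Q} < ennreal (\<nu> Q powr \<eta>)"
proof (rule ccontr)
  assume neg: "\<not> thesis"
  note witness = that
  define f where "f = (\<lambda>C. ennreal (\<nu> C powr \<eta>))"
  define s where "s = enn2real (infsum f {C\<in>CC. C \<subseteq> D})"
  have "infsum f {C\<in>CC. C \<subseteq> D} \<noteq> top" using small unfolding f_def by (auto simp: top_unique)
  then have s: "infsum f {C\<in>CC. C \<subseteq> D} = ennreal s" unfolding s_def by (simp add: less_top)
  have s0: "s \<ge> 0" by (simp add: s_def)
  have s1: "s < \<nu> D powr \<eta>"
    using small s s0 unfolding f_def[symmetric] by (simp add: ennreal_less_iff)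
  \<comment> \<open>Small enough that the deficit survives the factor \<open>1 + \<epsilon>\<close>.\<close>
  define \<epsilon> where "\<epsilon> = (\<nu> D powr \<eta> - s) / (s + 1)"
  have \<epsilon>: "\<epsilon> > 0" using s0 s1 by (simp add: \<epsilon>_def)
  have "(1 + \<epsilon>) * s < \<nu> D powr \<eta>"
  proof -
    have "\<epsilon> * s < \<epsilon> * (s + 1)" using \<epsilon> by (intro mult_strict_left_mono) auto
    also have "\<dots> = \<nu> D powr \<eta> - s" using s0 by (simp add: \<epsilon>_def)
    finally show ?thesis by (simp add: algebra_simps)
  qed
  from spr \<epsilon> obtain m K q where F: "frostman_family P \<nu> \<eta> U D \<epsilon> m K q"
    unfolding spreads_def by blast
  have K: "finite K" "K \<noteq> {}"
    and q: "\<And>k. k \<in> K \<Longrightarrow> q k \<in> dyadic_cubes_of P m \<and> closure (q k) \<subseteq> D \<and> q k \<subseteq> U \<and> 0 < \<nu> (q k)"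
    and cnt: "\<And>C. C \<in> dyadic_cubes P \<Longrightarrow> C \<subseteq> D \<Longrightarrow>
        real (card {k\<in>K. q k \<subseteq> C}) \<le> (1 + \<epsilon>) * real (card K) * (\<nu> C / \<nu> D) powr \<eta>"
    using F unfolding frostman_family_def by auto
  have qD: "q k \<subseteq> D" "q k \<in> dyadic_cubes P" "q k \<noteq> {}" if "k \<in> K" for k
    using q[OF that] closure_subset dyadic_cubes_of_subset dyadic_cube_nonempty by blast+
  have dich: "(\<exists>C\<in>CC. q k \<subseteq> C) \<or> f (q k) \<le> infsum f {C\<in>CC. C \<subseteq> q k}" if "k \<in> K" for k
  proof (rule ccontr)
    assume "\<not> ?thesis"
    then have no: "\<And>C. C \<in> CC \<Longrightarrow> \<not> q k \<subseteq> C"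
      and lt: "infsum f {C\<in>CC. C \<subseteq> q k} < f (q k)" by (auto simp: not_le)
    have thesis
      by (rule witness[of "q k"])
         (use q[OF \<open>k \<in> K\<close>] qD(2)[OF \<open>k \<in> K\<close>] no lt in \<open>simp_all add: f_def\<close>)
    with neg show False by simp
  qed
  define K1 where "K1 = {k\<in>K. \<exists>C\<in>CC. q k \<subseteq> C}"
  have "\<forall>k\<in>K1. \<exists>C. C \<in> CC \<and> q k \<subseteq> C" by (auto simp: K1_def)
  from bchoice[OF this] obtain c where c: "\<And>k. k \<in> K1 \<Longrightarrow> c k \<in> CC \<and> q k \<subseteq> c k"
    by auto
  define T1 where "T1 = c ` K1"
  define T2 where "T2 = q ` (K - K1)"
  have fin: "finite T1" "finite T2" using K by (auto simp: T1_def T2_def K1_def)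
  have T1: "T1 \<subseteq> {C\<in>CC. C \<subseteq> D}"
  proof -
    have "c k \<subseteq> D" if "k \<in> K1" for k
    proof -
      have "k \<in> K" using that by (auto simp: K1_def)
      have "c k \<inter> D \<noteq> {}" using c[OF that] qD[OF \<open>k \<in> K\<close>] by auto
      then show ?thesis
        using dyadic_cubes_comparable[of "c k" P D] c[OF that] CC D noC by blast
    qed
    then show ?thesis using c by (auto simp: T1_def)
  qed
  have T2: "Q \<in> dyadic_cubes P \<and> Q \<subseteq> D \<and> (\<forall>C\<in>CC. \<not> Q \<subseteq> C)" if "Q \<in> T2" for Q
    using that qD unfolding T2_def K1_def by auto
  have T12: "T1 \<inter> T2 = {}" using T1 T2 by blast
  have sub: "{C\<in>CC. C \<subseteq> Q} \<subseteq> {C\<in>CC. C \<subseteq> D}" if "Q \<in> T2" for Q using T2[OF that] by auto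
  have "real (card K) = (\<Sum>k\<in>K. 1)" by simp
  also have "\<dots> \<le> (\<Sum>k\<in>K. \<Sum>T\<in>T1 \<union> T2. of_bool (q k \<subseteq> T))"
  proof (rule sum_mono)
    fix k assume "k \<in> K"
    have "\<exists>T\<in>T1 \<union> T2. q k \<subseteq> T" using c \<open>k \<in> K\<close> by (cases "k \<in> K1") (auto simp: T1_def T2_def)
    then obtain T where "T \<in> T1 \<union> T2" "q k \<subseteq> T" by auto
    then show "(1::real) \<le> (\<Sum>T\<in>T1 \<union> T2. of_bool (q k \<subseteq> T))"
      using fin by (subst sum.remove[of _ T]) (auto intro!: sum_nonneg)
  qed
  also have "\<dots> = (\<Sum>T\<in>T1 \<union> T2. real (card {k\<in>K. q k \<subseteq> T}))"
    using K by (subst sum.swap) (simp add: Int_def)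
  also have "\<dots> \<le> (\<Sum>T\<in>T1 \<union> T2. (1 + \<epsilon>) * real (card K) * (\<nu> T / \<nu> D) powr \<eta>)"
    using T1 T2 CC by (intro sum_mono cnt) auto
  also have "\<dots> = (\<Sum>T\<in>T1 \<union> T2. real (card K) * ((1 + \<epsilon>) / \<nu> D powr \<eta> * \<nu> T powr \<eta>))"
    using nonneg D by (intro sum.cong) (auto simp: powr_divide)
  also have "\<dots> = real (card K) * ((1 + \<epsilon>) / \<nu> D powr \<eta> * (\<Sum>T\<in>T1 \<union> T2. \<nu> T powr \<eta>))"
    by (simp only: sum_distrib_left)
  finally have "real (card K) * 1 \<le> real (card K) * ((1 + \<epsilon>) / \<nu> D powr \<eta> * (\<Sum>T\<in>T1 \<union> T2. \<nu> T powr \<eta>))"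
    by simp
  moreover have "real (card K) > 0" using K by (simp add: card_gt_0_iff)
  ultimately have "1 \<le> (1 + \<epsilon>) / \<nu> D powr \<eta> * (\<Sum>T\<in>T1 \<union> T2. \<nu> T powr \<eta>)"
    by (rule mult_left_le_imp_le)
  then have ge: "\<nu> D powr \<eta> \<le> (1 + \<epsilon>) * (\<Sum>T\<in>T1 \<union> T2. \<nu> T powr \<eta>)"
    using D by (simp add: field_simps)
  have "ennreal (\<Sum>T\<in>T1 \<union> T2. \<nu> T powr \<eta>) = sum f T1 + sum f T2"
    using fin T12 by (simp add: f_def sum.union_disjoint sum_nonneg)
  also have "\<dots> \<le> infsum f T1 + (\<Sum>Q\<in>T2. infsum f {C\<in>CC. C \<subseteq> Q})"
    using dich fin by (intro add_mono sum_mono) (auto simp: T2_def K1_def)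
  also have "\<dots> = infsum f T1 + infsum f (\<Union>Q\<in>T2. {C\<in>CC. C \<subseteq> Q})"
  proof -
    have disj: "{C\<in>CC. C \<subseteq> Q} \<inter> {C\<in>CC. C \<subseteq> Q'} = {}" if "Q \<in> T2" "Q' \<in> T2" "Q \<noteq> Q'" for Q Q'
    proof -
      have "Q \<inter> Q' = {}"
        using that q dyadic_cubes_same_level[of Q P m Q'] unfolding T2_def by blast
      then have "C \<notin> CC" if "C \<subseteq> Q" "C \<subseteq> Q'" for C
        using that CC dyadic_cube_nonempty by blast
      then show ?thesis by blast
    qed
    have "(\<Sum>Q\<in>T2. infsum f {C\<in>CC. C \<subseteq> Q}) = infsum f (\<Union>Q\<in>T2. {C\<in>CC. C \<subseteq> Q})"
      by (rule sum_infsum[where B = "\<lambda>Q. {C\<in>CC. C \<subseteq> Q}", OF fin(2) ennreal_summable_on disj])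
    then show ?thesis by simp
  qed
  also have "\<dots> = infsum f (T1 \<union> (\<Union>Q\<in>T2. {C\<in>CC. C \<subseteq> Q}))"
  proof (rule infsum_Un_disjoint[symmetric])
    \<comment> \<open>A covering cube that contains a sample cube and lies in a second one would equal both, as sample
      cubes have the same level, so the second one would be covered as well.\<close>
    have False if "k \<in> K1" "j \<in> K - K1" "c k \<subseteq> q j" for k j
    proof -
      have "q k \<subseteq> q j" "k \<in> K" using that c by (auto simp: K1_def)
      then have "q k = q j"
        using dyadic_cubes_same_level[of "q k" P m "q j"] q[of k] q[of j] qD[of k] that(2) by blast
      then show False using that c[of k] by (auto simp: K1_def)
    qed
    then show "T1 \<inter> (\<Union>Q\<in>T2. {C\<in>CC. C \<subseteq> Q}) = {}" by (auto simp: T1_def T2_def)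
  qed (rule ennreal_summable_on)+
  also have "\<dots> \<le> infsum f {C\<in>CC. C \<subseteq> D}"
    using T1 sub by (intro ennreal_infsum_mono_set) blast
  finally have "(\<Sum>T\<in>T1 \<union> T2. \<nu> T powr \<eta>) \<le> s"
    unfolding s using s0 by (simp add: ennreal_le_iff)
  then have "\<nu> D powr \<eta> \<le> (1 + \<epsilon>) * s"
    using ge \<epsilon> by (meson add_nonneg_nonneg less_imp_le mult_left_mono order_trans zero_le_one)
  with \<open>(1 + \<epsilon>) * s < \<nu> D powr \<eta>\<close> show False by simp
qed

text \<open>Iterating \<open>exists_uncovered_subcube\<close> over the sets \<open>U k\<close> yields nested cubes that shrink to a point.
  The closures are compact and each lies in the previous cube, so the point lies in all \<open>U k\<close>; it lies
  in \<open>A\<close> because every cube meets the closed set \<open>A\<close>. A covering cube around it would eventually contain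
  the nested cubes, which the construction excludes.\<close>
lemma content_ge_of_spreads:
  fixes P :: "real^'n"
  assumes spr: "\<And>D k::nat. D \<in> dyadic_cubes P \<Longrightarrow> \<nu> D > 0 \<Longrightarrow> spreads P \<nu> \<eta> (U k) D"
    and nonneg: "\<And>S. 0 \<le> \<nu> S"
    and mono: "\<And>C D. C \<in> dyadic_cubes P \<Longrightarrow> D \<in> dyadic_cubes P \<Longrightarrow> C \<subseteq> D \<Longrightarrow> \<nu> C \<le> \<nu> D"
    and A: "closed A" and carrier: "\<And>Q. \<nu> Q > 0 \<Longrightarrow> Q \<inter> A \<noteq> {}"
    and "0 \<le> \<eta>"
    and D: "D \<in> dyadic_cubes P" and CC: "CC \<subseteq> dyadic_cubes P"
    and cover: "(\<Inter>k. U k) \<inter> A \<inter> D \<subseteq> \<Union>CC"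
  shows "ennreal (\<nu> D powr \<eta>) \<le> infsum (\<lambda>C. ennreal (\<nu> C powr \<eta>)) CC"
proof (rule ccontr)
  define f where "f = (\<lambda>C. ennreal (\<nu> C powr \<eta>))"
  assume "\<not> ?thesis"
  then have lt: "infsum f CC < f D" by (simp add: f_def not_le)
  then have "\<nu> D > 0" using nonneg[of D] by (cases "\<nu> D = 0") (auto simp: f_def)
  define good where "good = (\<lambda>Q. Q \<in> dyadic_cubes P \<and> \<nu> Q > 0 \<and> (\<forall>C\<in>CC. \<not> Q \<subseteq> C) \<and>
      infsum f {C\<in>CC. C \<subseteq> Q} < f Q)"
  have "\<not> D \<subseteq> C" if "C \<in> CC" for C
  proof
    assume "D \<subseteq> C"
    then have "f D \<le> f C"
      using mono[of D C] D CC that nonneg \<open>0 \<le> \<eta>\<close> unfolding f_def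
      by (intro ennreal_leI powr_mono2) auto
    also have "\<dots> \<le> infsum f CC" using sum_le_ennreal_infsum[of "{C}" CC f] that by simp
    finally show False using lt by simp
  qed
  moreover have "infsum f {C\<in>CC. C \<subseteq> D} < f D"
    using lt by (rule order.strict_trans1[rotated]) (auto intro: ennreal_infsum_mono_set)
  ultimately have gD: "good D" using D \<open>\<nu> D > 0\<close> by (simp add: good_def)
  have step: "\<exists>Q'. good Q' \<and> closure Q' \<subseteq> Q \<and> Q' \<subseteq> U k" if "good Q" for Q k
  proof -
    have Q: "Q \<in> dyadic_cubes P" "\<nu> Q > 0" "\<And>C. C \<in> CC \<Longrightarrow> \<not> Q \<subseteq> C"
      "infsum (\<lambda>C. ennreal (\<nu> C powr \<eta>)) {C\<in>CC. C \<subseteq> Q} < ennreal (\<nu> Q powr \<eta>)"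
      using that by (simp_all add: good_def f_def)
    show ?thesis
    proof (rule exists_uncovered_subcube[OF spr[OF Q(1,2), of k] Q(1,2) nonneg CC Q(3,4)])
      fix Q' assume "Q' \<in> dyadic_cubes P" "closure Q' \<subseteq> Q" "Q' \<subseteq> U k" "\<nu> Q' > 0"
        "\<And>C. C \<in> CC \<Longrightarrow> \<not> Q' \<subseteq> C"
        "infsum (\<lambda>C. ennreal (\<nu> C powr \<eta>)) {C\<in>CC. C \<subseteq> Q'} < ennreal (\<nu> Q' powr \<eta>)"
      then show ?thesis by (intro exI[of _ Q']) (simp add: good_def f_def)
    qed
  qed
  obtain F where F0: "F 0 = D" and F: "\<And>n. good (F n)"
      "\<And>n. closure (F (Suc n)) \<subseteq> F n \<and> F (Suc n) \<subseteq> U n"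
  proof -
    have "\<exists>F. \<forall>n. (good (F n) \<and> (n = 0 \<longrightarrow> F n = D)) \<and> (closure (F (Suc n)) \<subseteq> F n \<and> F (Suc n) \<subseteq> U n)"
      by (rule dependent_nat_choice) (use gD step in auto)
    then show ?thesis using that by blast
  qed
  have Fd: "F n \<in> dyadic_cubes P" for n using F(1) by (simp add: good_def)
  have dec: "F (Suc n) \<subseteq> F n" for n using F(2)[of n] closure_subset by blast
  have anti: "F n \<subseteq> F m" if "m \<le> n" for m n
    using lift_Suc_antimono_le[of F, OF dec that] .
  have "\<forall>n. \<exists>l. F n \<in> dyadic_cubes_of P l" using Fd by (auto simp: dyadic_cubes_def)
  from choice[OF this] obtain l where l: "\<And>n. F n \<in> dyadic_cubes_of P (l n)" by auto
  have lmono: "l n + 1 \<le> l (Suc n)" for n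
    using closure_dyadic_cube_subset_imp_finer[OF l[of "Suc n"] l[of n]] F(2)[of n] by simp
  have lge: "l 0 + int n \<le> l n" for n
  proof (induction n)
    case (Suc n) then show ?case using lmono[of n] by simp
  qed simp
  have "\<Inter>(range (\<lambda>n. closure (F n) \<inter> A)) \<noteq> {}"
  proof (rule compact_nest)
    show "compact (closure (F n) \<inter> A)" for n
      using A Fd dyadic_cube_bounded by (intro compact_Int_closed) (auto simp: compact_closure)
    show "closure (F n) \<inter> A \<noteq> {}" for n
      using carrier[of "F n"] F(1)[of n] closure_subset[of "F n"] by (auto simp: good_def)
    show "closure (F n) \<inter> A \<subseteq> closure (F m) \<inter> A" if "m \<le> n" for m n
      using closure_mono[OF anti[OF that]] by auto
  qed
  then obtain x where x: "\<And>n. x \<in> closure (F n)" "x \<in> A" by auto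
  have xF: "x \<in> F n" for n using x(1)[of "Suc n"] F(2)[of n] by blast
  then have "x \<in> (\<Inter>k. U k) \<inter> A \<inter> D" using F(2) x(2) F0 xF[of 0] by blast
  then obtain C where C: "C \<in> CC" "x \<in> C" using cover by blast
  obtain c where c: "C \<in> dyadic_cubes_of P c" using C CC dyadic_cubesE by blast
  define n where "n = nat (c - l 0)"
  have "c \<le> l n" using lge[of n] unfolding n_def by linarith
  then have "F n \<subseteq> C" using dyadic_cube_nested[OF c l[of n]] C xF by blast
  then show False using F(1)[of n] C by (auto simp: good_def)
qed

section \<open>Counting sample points\<close>

lemma exp_le_quadratic:
  fixes x :: real assumes "0 \<le> x" "x \<le> 1"
  shows "exp x \<le> 1 + x + x\<^sup>2"
  using exp_bound[OF assms] by simp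

text \<open>Markov's inequality for \<open>exp (\<epsilon>/2 \<cdot> count)\<close>, whose expectation factorises. The exponent
  \<open>\<epsilon>/2\<close> comes from minimising \<open>b (\<lambda> + \<lambda>\<^sup>2) - (1 + \<epsilon>) b \<lambda>\<close>.\<close>

lemma (in prob_space) chernoff_count:
  assumes ind: "indep_vars (\<lambda>_. N) X I" and J: "finite J" "J \<subseteq> I"
    and S: "S \<in> sets N"
    and b: "\<And>k. k \<in> J \<Longrightarrow> prob (X k -` S \<inter> space M) \<le> b"
    and \<epsilon>: "0 < \<epsilon>" "\<epsilon> \<le> 2"
  shows "prob {\<omega>\<in>space M. (1 + \<epsilon>) * (real (card J) * b) \<le> real (card {k\<in>J. X k \<omega> \<in> S})}
     \<le> exp (- (real (card J) * b * \<epsilon>\<^sup>2 / 4))" (is "prob ?E \<le> _")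
    and "{\<omega>\<in>space M. (1 + \<epsilon>) * (real (card J) * b) \<le> real (card {k\<in>J. X k \<omega> \<in> S})} \<in> events"
proof -
  define l where "l = \<epsilon> / 2"
  define Y where "Y = (\<lambda>k \<omega>. exp (l * indicator S (X k \<omega>)) :: real)"
  have ind': "indep_vars (\<lambda>_. N) X J" using ind J(2) by (rule indep_vars_subset)
  have Xm [measurable]: "k \<in> J \<Longrightarrow> X k \<in> measurable M N" for k
    using ind' by (auto simp: indep_vars_def)
  note S [measurable]
  have indY: "indep_vars (\<lambda>_. borel) Y J"
    unfolding Y_def by (rule indep_vars_compose2[OF ind']) measurable
  have Ym [measurable]: "k \<in> J \<Longrightarrow> Y k \<in> borel_measurable M" for k
    unfolding Y_def by measurable
  have Yint: "k \<in> J \<Longrightarrow> integrable M (Y k)" for k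
    by (rule integrable_const_bound[where B = "exp l"])
       (use \<epsilon> in \<open>auto simp: Y_def l_def indicator_def\<close>)
  have count: "l * real (card {k\<in>J. X k \<omega> \<in> S}) = (\<Sum>k\<in>J. l * indicator S (X k \<omega>))" for \<omega>
    using J(1) by (simp add: sum_distrib_left[symmetric] indicator_def if_distrib sum.If_cases Int_def
        cong: if_cong)
  have prodY: "(\<Prod>k\<in>J. Y k \<omega>) = exp (l * real (card {k\<in>J. X k \<omega> \<in> S}))" for \<omega>
    unfolding count Y_def by (rule exp_sum[OF J(1), symmetric])
  have EY: "expectation (Y k) \<le> exp (b * (exp l - 1))" if "k \<in> J" for k
  proof -
    define A where "A = X k -` S \<inter> space M"
    have A: "A \<in> events" unfolding A_def using that S by measurable
    have "expectation (Y k) = expectation (\<lambda>\<omega>. 1 + (exp l - 1) * indicator A \<omega>)"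
      by (rule Bochner_Integration.integral_cong) (auto simp: Y_def A_def indicator_def)
    also have "\<dots> = 1 + (exp l - 1) * prob A"
      using A by (subst Bochner_Integration.integral_add)
        (auto simp: prob_space emeasure_eq_measure intro!: integrable_real_indicator)
    also have "\<dots> \<le> 1 + (exp l - 1) * b"
      using b[OF that] \<epsilon> unfolding A_def l_def by (intro add_left_mono mult_left_mono) auto
    also have "\<dots> \<le> exp (b * (exp l - 1))"
      by (metis exp_ge_add_one_self mult.commute)
    finally show ?thesis .
  qed
  define c where "c = exp (l * ((1 + \<epsilon>) * (real (card J) * b)))"
  have E_eq: "?E = {\<omega>\<in>space M. c \<le> (\<Prod>k\<in>J. Y k \<omega>)}"
    unfolding prodY c_def using \<epsilon> by (auto simp: l_def)
  show ev: "?E \<in> events"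
    unfolding E_eq by measurable
  have "prob ?E \<le> expectation (\<lambda>\<omega>. \<Prod>k\<in>J. Y k \<omega>) / c"
    unfolding E_eq
    by (rule integral_Markov_inequality_measure[where A = "{}"])
       (auto simp: c_def prodY intro!: indep_vars_integrable[OF J(1) indY Yint, unfolded prodY])
  also have "expectation (\<lambda>\<omega>. \<Prod>k\<in>J. Y k \<omega>) = (\<Prod>k\<in>J. expectation (Y k))"
    by (rule indep_vars_lebesgue_integral[OF J(1) indY Yint])
  also have "\<dots> / c \<le> (\<Prod>k\<in>J. exp (b * (exp l - 1))) / c"
    by (intro divide_right_mono prod_mono conjI EY)
       (auto simp: Y_def c_def)
  also have "\<dots> = exp (real (card J) * b * ((exp l - 1) - l * (1 + \<epsilon>)))"
    by (simp add: c_def exp_of_nat_mult[symmetric] exp_diff[symmetric] algebra_simps)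
  also have "\<dots> \<le> exp (real (card J) * b * (- (\<epsilon>\<^sup>2 / 4)))"
  proof (cases "J = {}")
    case False
    then have "b \<ge> 0" using b measure_nonneg order_trans by (metis ex_in_conv)
    have "exp l \<le> 1 + l + l\<^sup>2" using \<epsilon> by (intro exp_le_quadratic) (auto simp: l_def)
    moreover have "l * (1 + \<epsilon>) = l + 2 * l\<^sup>2" "\<epsilon>\<^sup>2 / 4 = l\<^sup>2"
      by (auto simp: l_def power2_eq_square field_simps)
    ultimately have "(exp l - 1) - l * (1 + \<epsilon>) \<le> - (\<epsilon>\<^sup>2 / 4)"
      by linarith
    then show ?thesis using \<open>b \<ge> 0\<close> by (intro exp_mono mult_left_mono) auto
  qed simp
  finally show "prob ?E \<le> exp (- (real (card J) * b * \<epsilon>\<^sup>2 / 4))" by simp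
qed

text \<open>One good scale is enough for each requirement, so failure probabilities only have to tend to
  \<open>0\<close>.\<close>
lemma (in prob_space) AE_of_vanishing_failure:
  assumes F: "\<And>m. m0 \<le> m \<Longrightarrow> F m \<in> events" "(\<lambda>m. prob (F m)) \<longlonglongrightarrow> 0"
    and Q: "\<And>m \<omega>. m0 \<le> m \<Longrightarrow> \<omega> \<in> space M \<Longrightarrow> \<omega> \<notin> F m \<Longrightarrow> Q \<omega>"
  shows "AE \<omega> in M. Q \<omega>"
proof -
  define Z where "Z = (\<Inter>m\<in>{m0..}. F m)"
  have Z: "Z \<in> events" unfolding Z_def using F(1) by (intro sets.countable_INT') auto
  have "prob Z \<le> 0"
  proof (rule tendsto_lowerbound[OF F(2)])
    show "\<forall>\<^sub>F m in sequentially. prob Z \<le> prob (F m)"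
      using eventually_ge_at_top[of m0]
    proof eventually_elim
      case (elim m)
      then show ?case unfolding Z_def using F(1) by (intro finite_measure_mono) auto
    qed
  qed simp
  then have "prob Z = 0" by (simp add: measure_le_0_iff)
  then have "Z \<in> null_sets M" using Z by (simp add: null_sets_def emeasure_eq_measure)
  then show ?thesis
    by (rule AE_I') (use Q in \<open>auto simp: Z_def\<close>)
qed

text \<open>The number of cubes to control grows exponentially in the level \<open>m\<close>, the deviation
  probabilities decay doubly exponentially.\<close>

lemma exp_double_exp_tendsto_0:
  fixes a \<gamma> t :: real and L :: nat
  assumes "a > 0" "\<gamma> > 0"
  shows "(\<lambda>m. real (m + L) * 2 powr (real m * t) * exp (- (a * 2 powr (real m * \<gamma>)))) \<longlonglongrightarrow> 0"
proof -
  define k where "k = nat \<lceil>(\<bar>t\<bar> + 1) / \<gamma>\<rceil>"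
  define z where "z = (\<lambda>m. a * 2 powr (real m * \<gamma>))"
  have k: "\<bar>t\<bar> + 1 \<le> \<gamma> * real k"
  proof -
    have "(\<bar>t\<bar> + 1) / \<gamma> \<le> real k" unfolding k_def by (rule real_nat_ceiling_ge)
    then show ?thesis using assms by (simp add: field_simps)
  qed
  have zlim: "filterlim z at_top sequentially"
  proof -
    have "filterlim (\<lambda>m. (\<gamma> * ln 2) * real m) at_top sequentially"
      using assms by (intro filterlim_tendsto_pos_mult_at_top[OF tendsto_const _ filterlim_real_sequentially]) simp
    then have "filterlim (\<lambda>m. exp ((\<gamma> * ln 2) * real m)) at_top sequentially"
      by (rule filterlim_compose[OF exp_at_top])
    then have "filterlim (\<lambda>m. a * exp ((\<gamma> * ln 2) * real m)) at_top sequentially"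
      by (rule filterlim_tendsto_pos_mult_at_top[OF tendsto_const \<open>a > 0\<close>])
    then show ?thesis by (simp add: z_def[abs_def] powr_def mult_ac)
  qed
  have "(\<lambda>m. (1 + real L) / a ^ k * (z m ^ k / exp (z m))) \<longlonglongrightarrow> (1 + real L) / a ^ k * 0"
    by (intro tendsto_mult tendsto_const filterlim_compose[OF tendsto_power_div_exp_0 zlim])
  then have lim: "(\<lambda>m. (1 + real L) / a ^ k * (z m ^ k / exp (z m))) \<longlonglongrightarrow> 0" by simp
  have "real (m + L) * 2 powr (real m * t) * exp (- (a * 2 powr (real m * \<gamma>)))
      \<le> (1 + real L) / a ^ k * (z m ^ k / exp (z m))" for m
  proof -
    have "real (m + L) \<le> (1 + real L) * 2 ^ m"
    proof -
      have a: "real m \<le> 2 ^ m" by (simp add: less_imp_le)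
      have b: "real L * 1 \<le> real L * 2 ^ m" by (intro mult_left_mono) auto
      show ?thesis unfolding distrib_right of_nat_add using a b by linarith
    qed
    then have "real (m + L) * 2 powr (real m * t) \<le> (1 + real L) * 2 ^ m * 2 powr (real m * t)"
      by (intro mult_right_mono) auto
    also have "\<dots> = (1 + real L) * 2 powr (real m * (t + 1))"
      by (simp add: powr_realpow[symmetric] algebra_simps flip: powr_add)
    also have "\<dots> \<le> (1 + real L) * 2 powr (real m * (\<gamma> * real k))"
      using k by (intro mult_left_mono powr_mono) auto
    also have "\<dots> = (1 + real L) / a ^ k * z m ^ k"
      using assms by (simp add: z_def power_mult_distrib powr_realpow[symmetric] powr_powr mult.assoc)
    finally have "real (m + L) * 2 powr (real m * t) * exp (- z m) \<le> (1 + real L) / a ^ k * z m ^ k * exp (- z m)"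
      by (intro mult_right_mono) auto
    then show ?thesis by (simp add: z_def exp_minus divide_inverse)
  qed
  then show ?thesis
    by (intro tendsto_sandwich[OF _ _ tendsto_const lim]) (auto intro!: always_eventually)
qed

section \<open>Random balls spread out\<close>

context borel_prob
begin

lemma null_frontier_dyadic_cube:
  assumes null: "emeasure \<mu> (dyadic_boundaries P) = 0" and D: "D \<in> dyadic_cubes P"
  shows "measure \<mu> (frontier D) = 0"
proof -
  have "frontier D \<subseteq> dyadic_boundaries P"
    using D unfolding dyadic_boundaries_def dyadic_cubes_def by blast
  moreover have "dyadic_boundaries P \<in> sets \<mu>"
    unfolding dyadic_boundaries_def sets_eq
    by (intro sets.countable_UN'' countable_dyadic_cubes_of borel_closed frontier_closed) auto
  ultimately have "emeasure \<mu> (frontier D) \<le> 0" using null emeasure_mono by metis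
  then show ?thesis by (simp add: measure_def)
qed

text \<open>An interior point of \<open>D\<close> eventually has its whole closed cell inside \<open>D\<close>, and the
  boundary of \<open>D\<close> is a null set.\<close>
lemma measure_cells_near_boundary_tendsto_0:
  assumes null: "emeasure \<mu> (dyadic_boundaries P) = 0" and D: "D \<in> dyadic_cubes P"
  shows "(\<lambda>m. measure \<mu> {x\<in>D. \<not> closure (cell (2 powi (- int m)) P (index (2 powi (- int m)) P x)) \<subseteq> D}) \<longlonglongrightarrow> 0"
    (is "(\<lambda>m. measure \<mu> (?B m)) \<longlonglongrightarrow> 0")
proof -
  have B: "?B m \<in> sets \<mu>" for m
  proof -
    have "?B m = D \<inter> {x. \<not> closure (cell (2 powi (- int m)) P (index (2 powi (- int m)) P x)) \<subseteq> D}" by auto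
    then show ?thesis
      using sets.Int[OF dyadic_cube_borel[OF D] sets_Collect_index] unfolding sets_eq by simp
  qed
  have sub: "cell (2 powi (- int n)) P (index (2 powi (- int n)) P x)
      \<subseteq> cell (2 powi (- int m)) P (index (2 powi (- int m)) P x)" if "m \<le> n" for m n x
  proof (rule dyadic_cube_nested[OF cell_in_dyadic_cubes_of cell_in_dyadic_cubes_of])
    show "int m \<le> int n" using that by simp
    show "cell (2 powi (- int m)) P (index (2 powi (- int m)) P x)
        \<inter> cell (2 powi (- int n)) P (index (2 powi (- int n)) P x) \<noteq> {}"
      using mem_cell_index[of x _ P] by blast
  qed
  have "decseq ?B"
  proof (rule antimonoI)
    fix m n :: nat assume "m \<le> n"
    then show "?B n \<subseteq> ?B m" using closure_mono[OF sub] by blast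
  qed
  then have lim: "(\<lambda>m. measure \<mu> (?B m)) \<longlonglongrightarrow> measure \<mu> (\<Inter>m. ?B m)"
    using B by (intro finite_Lim_measure_decseq) auto
  have "(\<Inter>m. ?B m) \<subseteq> frontier D"
  proof
    fix x assume x: "x \<in> (\<Inter>m. ?B m)"
    have "x \<notin> interior D"
    proof
      assume "x \<in> interior D"
      then obtain e where e: "e > 0" "cball x e \<subseteq> D" by (auto simp: mem_interior_cball)
      have "(\<lambda>m. real CARD('n) * (1 / 2) ^ m) \<longlonglongrightarrow> real CARD('n) * 0"
        by (intro tendsto_mult tendsto_const LIMSEQ_power_zero) simp
      then have "\<forall>\<^sub>F m in sequentially. real CARD('n) * (1 / 2) ^ m < e"
        using e by (intro order_tendstoD) auto
      then obtain m where m: "real CARD('n) * (1 / 2) ^ m < e"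
        by (auto simp: eventually_sequentially)
      have "cell (2 powi (- int m)) P (index (2 powi (- int m)) P x) \<subseteq> cball x e"
      proof
        fix y assume "y \<in> cell (2 powi (- int m)) P (index (2 powi (- int m)) P x)"
        then have "dist x y < real CARD('n) * 2 powi (- int m)"
          by (intro cell_dist[OF _ mem_cell_index]) auto
        then show "y \<in> cball x e" using m by (simp add: side_eq)
      qed
      then have "closure (cell (2 powi (- int m)) P (index (2 powi (- int m)) P x)) \<subseteq> cball x e"
        by (rule closure_minimal) simp
      then show False using x e by blast
    qed
    then show "x \<in> frontier D" using x closure_subset[of D] by (auto simp: frontier_def)
  qed
  then have "measure \<mu> (\<Inter>m. ?B m) \<le> measure \<mu> (frontier D)"
    by (intro finite_measure_mono) (auto simp: sets_eq)
  then have "measure \<mu> (\<Inter>m. ?B m) = 0"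
    using null_frontier_dyadic_cube[OF null D] by (simp add: measure_le_0_iff)
  with lim show ?thesis by simp
qed

text \<open>The points whose cell of level \<open>m\<close> may serve as a cube of the Frostman family.\<close>
definition good_points where
  "good_points P A D t m = {x \<in> A \<inter> D.
     closure (cell (2 powi (- int m)) P (index (2 powi (- int m)) P x)) \<subseteq> D \<and>
     (2 powi (- int m)) powr t \<le> measure \<mu> (A \<inter> cell (2 powi (- int m)) P (index (2 powi (- int m)) P x))}"

lemma good_points_borel:
  assumes D: "D \<in> dyadic_cubes P" and A: "A \<in> sets borel"
  shows "good_points P A D t m \<in> sets borel"
proof -
  have "good_points P A D t m = A \<inter> D \<inter> {x. closure (cell (2 powi (- int m)) P (index (2 powi (- int m)) P x)) \<subseteq> D \<and>
     (2 powi (- int m)) powr t \<le> measure \<mu> (A \<inter> cell (2 powi (- int m)) P (index (2 powi (- int m)) P x))}"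
    by (auto simp: good_points_def)
  also have "\<dots> \<in> sets borel"
    using A dyadic_cube_borel[OF D] by (intro sets.Int sets_Collect_index)
  finally show ?thesis .
qed

lemma good_points_tendsto:
  assumes null: "emeasure \<mu> (dyadic_boundaries P) = 0" and D: "D \<in> dyadic_cubes P"
    and A: "A \<in> sets borel" and t: "critical_s \<mu> < ereal t" and c: "c < measure \<mu> (A \<inter> D)"
  shows "\<forall>\<^sub>F m in sequentially. c \<le> measure \<mu> (good_points P A D t m)"
proof -
  let ?r = "\<lambda>m. 2 powi (- int m) :: real"
  let ?B = "\<lambda>m. {x\<in>D. \<not> closure (cell (?r m) P (index (?r m) P x)) \<subseteq> D}"
  let ?L = "\<lambda>m. {x\<in>A \<inter> D. measure \<mu> (A \<inter> cell (?r m) P (index (?r m) P x)) < ?r m powr t}"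
  have L: "(\<lambda>m. measure \<mu> (?L m)) \<longlonglongrightarrow> 0"
    using measure_light_translated_cells_tendsto_0[OF dyadic_cube_bounded[OF D] dyadic_cube_borel[OF D] A t, of P]
    by (rule filterlim_compose[OF _ filterlim_side])
  have "(\<lambda>m. measure \<mu> (?L m) + measure \<mu> (?B m)) \<longlonglongrightarrow> 0 + 0"
    by (intro tendsto_add L measure_cells_near_boundary_tendsto_0[OF null D])
  then have "\<forall>\<^sub>F m in sequentially. measure \<mu> (?L m) + measure \<mu> (?B m) < measure \<mu> (A \<inter> D) - c"
    using c by (intro order_tendstoD) auto
  then show ?thesis
  proof eventually_elim
    case (elim m)
    have "?L m = A \<inter> D \<inter> {x. measure \<mu> (A \<inter> cell (?r m) P (index (?r m) P x)) < ?r m powr t}" by auto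
    then have mL: "?L m \<in> sets \<mu>"
      unfolding sets_eq using sets.Int[OF sets.Int[OF A dyadic_cube_borel[OF D]] sets_Collect_index] by simp
    have "?B m = D \<inter> {x. \<not> closure (cell (?r m) P (index (?r m) P x)) \<subseteq> D}" by auto
    then have mB: "?B m \<in> sets \<mu>"
      unfolding sets_eq using sets.Int[OF dyadic_cube_borel[OF D] sets_Collect_index] by simp
    have "measure \<mu> (A \<inter> D) \<le> measure \<mu> (good_points P A D t m) + measure \<mu> (A \<inter> D - good_points P A D t m)"
      by (rule measure_le_add_Diff) (use good_points_borel[OF D A] sets_eq in simp)
    also have "measure \<mu> (A \<inter> D - good_points P A D t m) \<le> measure \<mu> (?L m \<union> ?B m)"
    proof (rule finite_measure_mono)
      show "A \<inter> D - good_points P A D t m \<subseteq> ?L m \<union> ?B m" by (auto simp: good_points_def)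
    qed (rule sets.Un[OF mL mB])
    also have "measure \<mu> (?L m \<union> ?B m) \<le> measure \<mu> (?L m) + measure \<mu> (?B m)"
      by (rule measure_Un_le[OF mL mB])
    finally show ?case using elim by simp
  qed
qed

text \<open>The cubes at which the sample has to be controlled: any dyadic cube inside \<open>D\<close> that contains a
  cube of a good point is one of them.\<close>
definition heavy_cubes where
  "heavy_cubes P A l \<delta> m = {C \<in> (\<Union>n\<in>{l..int m}. dyadic_cubes_of P n). \<delta> \<le> measure \<mu> (A \<inter> C)}"

lemma heavy_cubes_card:
  assumes "\<delta> > 0" "A \<in> sets borel"
  shows "finite (heavy_cubes P A l \<delta> m)"
    and "real (card (heavy_cubes P A l \<delta> m)) * \<delta> \<le> real (m + nat (1 - l))"
proof -
  define H where "H = (\<lambda>n. cell (2 powi (-n)) P ` {k. \<delta> \<le> measure \<mu> (A \<inter> cell (2 powi (-n)) P k)})"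
  have eq: "heavy_cubes P A l \<delta> m = (\<Union>n\<in>{l..int m}. H n)"
    by (auto simp: heavy_cubes_def H_def dyadic_cubes_of_def dyadic_cube_eq_cell)
  have fin: "finite (H n)" for n
    unfolding H_def using heavy_cells(1)[OF assms] by auto
  then show "finite (heavy_cubes P A l \<delta> m)" unfolding eq by auto
  have c: "real (card (H n)) * \<delta> \<le> 1" for n
  proof -
    have "real (card (H n)) * \<delta> \<le> real (card {k. \<delta> \<le> measure \<mu> (A \<inter> cell (2 powi (-n)) P k)}) * \<delta>"
      unfolding H_def using heavy_cells(1)[OF assms] assms(1)
      by (intro mult_right_mono of_nat_mono card_image_le) auto
    also have "\<dots> \<le> 1" by (rule heavy_cells(2)[OF assms])
    finally show ?thesis .
  qed
  have "real (card (heavy_cubes P A l \<delta> m)) * \<delta> \<le> real (\<Sum>n\<in>{l..int m}. card (H n)) * \<delta>"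
    unfolding eq using assms(1) by (intro mult_right_mono of_nat_mono card_UN_le) auto
  also have "\<dots> = (\<Sum>n\<in>{l..int m}. real (card (H n)) * \<delta>)"
    by (simp add: sum_distrib_right)
  also have "\<dots> \<le> (\<Sum>n\<in>{l..int m}. 1)" by (intro sum_mono c)
  also have "\<dots> \<le> real (m + nat (1 - l))" by simp
  finally show "real (card (heavy_cubes P A l \<delta> m)) * \<delta> \<le> real (m + nat (1 - l))" .
qed

end

lemma frostman_family_mono_eps:
  assumes "frostman_family P \<nu> \<eta> U D \<epsilon> m K q" "\<epsilon> \<le> \<epsilon>'"
  shows "frostman_family P \<nu> \<eta> U D \<epsilon>' m K q"
proof -
  have "(1 + \<epsilon>) * real (card K) * (\<nu> C / \<nu> D) powr \<eta> \<le> (1 + \<epsilon>') * real (card K) * (\<nu> C / \<nu> D) powr \<eta>" for C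
    using assms(2) by (intro mult_right_mono) auto
  then show ?thesis using assms(1) unfolding frostman_family_def by (meson order_trans)
qed

context borel_prob
begin

text \<open>Separates the geometry from the probability: the two numerical bounds \<open>many\<close> and \<open>few\<close> on the
  sample are all that remains to be shown with high probability.\<close>
lemma frostman_family_of_sample:
  fixes x :: "nat \<Rightarrow> real^'n" and P :: "real^'n"
  assumes A: "A \<in> sets borel" and D: "D \<in> dyadic_cubes_of P l" and v: "measure \<mu> (A \<inter> D) > 0"
    and e: "0 < e" "e < 1"
    and N: "N > 0" "k0 \<le> N" and rad: "real CARD('n) * 2 powi (- int m) \<le> real (2 * N) powr (- \<alpha>)" "\<alpha> > 0"
    and many: "real N * ((1 - e) * measure \<mu> (A \<inter> D))
        \<le> real (card {k\<in>{N..<2*N}. x k \<in> good_points P A D t m})" 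
    and few: "\<And>C. C \<in> heavy_cubes P A l ((2 powi (- int m)) powr t) m \<Longrightarrow> C \<subseteq> D \<Longrightarrow>
        real (card {k\<in>{N..<2*N}. x k \<in> A \<inter> C})
          \<le> (1 + e) * (real N * (measure \<mu> (A \<inter> D) * (measure \<mu> (A \<inter> C) / measure \<mu> (A \<inter> D)) powr \<eta>))"
  shows "\<exists>m K q. frostman_family P (\<lambda>S. measure \<mu> (A \<inter> S)) \<eta>
       (\<Union>n\<in>{k0..}. ball (x n) (real n powr (- \<alpha>))) D ((1 + e) / (1 - e) - 1) m K q"
proof -
  define r where "r = (2 powi (- int m) :: real)"
  have r: "r > 0" by (simp add: r_def)
  define v where "v = measure \<mu> (A \<inter> D)"
  have v: "v > 0" using assms(3) by (simp add: v_def)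
  define K where "K = {k\<in>{N..<2*N}. x k \<in> good_points P A D t m}"
  define q where "q = (\<lambda>k. cell r P (index r P (x k)))"
  have finK: "finite K" by (simp add: K_def)
  have cK: "real N * ((1 - e) * v) \<le> real (card K)" using many by (simp add: K_def v_def)
  have "0 < real N * ((1 - e) * v)" using N e v by simp
  with cK have "K \<noteq> {}" by auto
  have xq: "x k \<in> q k" for k unfolding q_def by (rule mem_cell_index)
  have ql: "q k \<in> dyadic_cubes_of P (int m)" for k
    unfolding q_def r_def by (rule cell_in_dyadic_cubes_of)
  have good: "closure (q k) \<subseteq> D" "r powr t \<le> measure \<mu> (A \<inter> q k)" "x k \<in> A" if "k \<in> K" for k
    using that by (auto simp: K_def good_points_def q_def r_def)
  have "frostman_family P (\<lambda>S. measure \<mu> (A \<inter> S)) \<eta>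
       (\<Union>n\<in>{k0..}. ball (x n) (real n powr (- \<alpha>))) D ((1 + e) / (1 - e) - 1) (int m) K q"
    unfolding frostman_family_def
  proof (intro conjI ballI impI)
    fix k assume k: "k \<in> K"
    then have kN: "N \<le> k" "k \<le> 2 * N" by (auto simp: K_def)
    show "q k \<in> dyadic_cubes_of P (int m)" by (rule ql)
    show "closure (q k) \<subseteq> D" by (rule good(1)[OF k])
    show "0 < measure \<mu> (A \<inter> q k)" using good(2)[OF k] r by (smt (verit) powr_gt_zero)
    have "q k \<subseteq> ball (x k) (real k powr (- \<alpha>))"
    proof
      fix y assume "y \<in> q k"
      then have "dist (x k) y < real CARD('n) * r"
        unfolding q_def by (intro cell_dist[OF r mem_cell_index])
      also have "\<dots> \<le> real (2 * N) powr (- \<alpha>)" using rad by (simp add: r_def)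
      also have "\<dots> \<le> real k powr (- \<alpha>)"
        using kN N rad(2) by (intro powr_mono2') auto
      finally show "y \<in> ball (x k) (real k powr (- \<alpha>))" by simp
    qed
    moreover have "ball (x k) (real k powr (- \<alpha>)) \<subseteq> (\<Union>n\<in>{k0..}. ball (x n) (real n powr (- \<alpha>)))"
      using kN N by (intro UN_upper) auto
    ultimately show "q k \<subseteq> (\<Union>n\<in>{k0..}. ball (x n) (real n powr (- \<alpha>)))" by (rule order_trans)
  next
    fix C assume C: "C \<in> dyadic_cubes P" "C \<subseteq> D"
    let ?b = "(measure \<mu> (A \<inter> C) / v) powr \<eta>"
    show "real (card {k\<in>K. q k \<subseteq> C})
        \<le> (1 + ((1 + e) / (1 - e) - 1)) * real (card K) * (measure \<mu> (A \<inter> C) / measure \<mu> (A \<inter> D)) powr \<eta>"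
    proof (cases "\<exists>k\<in>K. q k \<subseteq> C")
      case False
      then have "{k\<in>K. q k \<subseteq> C} = {}" by auto
      then have "real (card {k\<in>K. q k \<subseteq> C}) = 0" by (simp only: card.empty of_nat_0)
      then show ?thesis using e by simp
    next
      case True
      then obtain k where k: "k \<in> K" "q k \<subseteq> C" by auto
      obtain n where n: "C \<in> dyadic_cubes_of P n" using C dyadic_cubesE by blast
      have Cb: "C \<in> sets borel" and Db: "D \<in> sets borel"
        using dyadic_cube_borel C D dyadic_cubes_of_subset by blast+
      have "\<exists>n\<in>{l..int m}. C \<in> dyadic_cubes_of P n"
      proof -
        have "C \<noteq> {}" using C dyadic_cube_nonempty by blast
        have "\<exists>n\<ge>l. n \<le> int m \<and> C \<in> dyadic_cubes_of P n \<or> n = l \<and> C \<in> dyadic_cubes_of P n"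
        proof (cases "n < l")
          case True
          then have "D \<subseteq> C"
            using dyadic_cube_nested[OF n D] C \<open>C \<noteq> {}\<close> by auto
          then show ?thesis using C D by (intro exI[of _ l]) auto
        next
          case nl: False
          show ?thesis
          proof (cases "n \<le> int m")
            case True
            then show ?thesis using nl n by (intro exI[of _ n]) auto
          next
            case False
            have "C \<subseteq> q k"
              by (rule dyadic_cube_nested[OF ql n]) (use k xq False in auto)
            then have "C = q k" using k by auto
            then have "C \<in> dyadic_cubes_of P (int m)" using ql by simp
            moreover have "l < int m"
              using closure_dyadic_cube_subset_imp_finer[OF ql D good(1)[OF k(1)]] .
            ultimately show ?thesis by (intro exI[of _ "int m"]) auto
          qed
        qed
        moreover have "l < int m"
          using closure_dyadic_cube_subset_imp_finer[OF ql D good(1)[OF k(1)]] .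
        ultimately show ?thesis by auto
      qed
      moreover have "measure \<mu> (A \<inter> q k) \<le> measure \<mu> (A \<inter> C)"
        using k(2) A Cb by (intro finite_measure_mono) (auto simp: sets_eq)
      ultimately have heavy: "C \<in> heavy_cubes P A l (r powr t) m"
        using good(2)[OF k(1)] by (auto simp: heavy_cubes_def)
      have "real (card {k\<in>K. q k \<subseteq> C}) \<le> real (card {k\<in>{N..<2*N}. x k \<in> A \<inter> C})"
        using xq good(3) by (intro of_nat_mono card_mono) (auto simp: K_def)
      also have "\<dots> \<le> (1 + e) * (real N * (v * ?b))"
        using few[OF heavy[unfolded r_def] C(2)] by (simp add: v_def)
      also have "\<dots> = (1 + e) / (1 - e) * (real N * ((1 - e) * v)) * ?b" using e by simp
      also have "\<dots> \<le> (1 + e) / (1 - e) * real (card K) * ?b"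
        using cK e by (intro mult_right_mono mult_left_mono) auto
      finally show ?thesis by (simp add: v_def)
    qed
  qed (use finK \<open>K \<noteq> {}\<close> in auto)
  then show ?thesis by blast
qed

text \<open>For each heavy cube \<open>C\<close> the bound \<open>b C\<close> is at least its probability, so that Chernoff's inequality
  applies, and at least a constant times \<open>2 powr (- (m t \<eta>))\<close>, so that the failure probability is
  doubly exponentially small in \<open>m\<close>. The lower bound on the number of good points is an upper bound on
  the number of points that are not good.\<close>
lemma AE_frostman_family:
  fixes P :: "real^'n" and M :: "'w measure" and X :: "nat \<Rightarrow> 'w \<Rightarrow> real^'n"
  assumes M: "prob_space M" and ind: "prob_space.indep_vars M (\<lambda>_. borel) X {1..}"
    and distr: "\<And>n. n \<ge> 1 \<Longrightarrow> distr M borel (X n) = \<mu>"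
    and null: "emeasure \<mu> (dyadic_boundaries P) = 0" and A: "A \<in> sets borel"
    and D: "D \<in> dyadic_cubes P" and pos: "measure \<mu> (A \<inter> D) > 0"
    and \<alpha>: "\<alpha> > 0" and \<eta>: "0 < \<eta>" "\<eta> \<le> 1"
    and t: "critical_s \<mu> < ereal t" "t > 0" "\<alpha> * t * \<eta> < 1" and \<epsilon>: "\<epsilon> > 0"
  shows "AE \<omega> in M. \<exists>m K q. frostman_family P (\<lambda>S. measure \<mu> (A \<inter> S)) \<eta>
       (\<Union>n\<in>{k0..}. ball (X n \<omega>) (real n powr (- \<alpha>))) D \<epsilon> m K q"
proof -
  interpret M: prob_space M by fact
  obtain l where l: "D \<in> dyadic_cubes_of P l" using D dyadic_cubesE by blast
  have Db: "D \<in> sets borel" using D by (rule dyadic_cube_borel)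
  define v where "v = measure \<mu> (A \<inter> D)"
  have v: "0 < v" "v \<le> 1" using pos by (auto simp: v_def)
  \<comment> \<open>The loss \<open>(1 + e) / (1 - e)\<close> from too many points in \<open>C\<close> and too few good points is \<open>1 + \<epsilon>\<close>.\<close>
  define e where "e = \<epsilon> / (2 + \<epsilon>)"
  have e: "0 < e" "e < 1" "(1 + e) / (1 - e) - 1 = \<epsilon>"
    using \<epsilon> by (auto simp: e_def field_simps)
  \<comment> \<open>The points that are not good have probability at most \<open>b'\<close> at fine scales; \<open>e'\<close> keeps their
    proportion below \<open>1 - (1 - e) v\<close>.\<close>
  define e' where "e' = e * v / 2"
  define b' where "b' = 1 - (1 - e / 2) * v"
  have lt_v: "(1 - e / 2) * v < 1 * v" using e v by (intro mult_strict_right_mono) auto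
  have "0 \<le> (1 - e / 2) * v" using e v by simp
  with lt_v have b': "0 < b'" "b' \<le> 1" unfolding b'_def using v(2) by linarith+
  have "e * v \<le> 1 * 1" using e v by (intro mult_mono) auto
  then have e': "0 < e'" "e' \<le> 2" using e v by (auto simp: e'_def)
  define \<gamma> where "\<gamma> = 1 / \<alpha> - t * \<eta>"
  have \<gamma>: "\<gamma> > 0" using t(3) \<alpha> by (simp add: \<gamma>_def field_simps)
  \<comment> \<open>With \<open>N = c 2 powr (m / \<alpha>)\<close> the radius \<open>(2 N) powr (- \<alpha>)\<close> is the bound \<open>CARD('n) 2 powr (- m)\<close> on
    the diameter of a cube of level \<open>m\<close>.\<close>
  define c where "c = real CARD('n) powr (- (1 / \<alpha>)) / 2"
  have c: "c > 0" by (simp add: c_def)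
  define N where "N = (\<lambda>m::nat. nat \<lfloor>c * 2 powr (real m / \<alpha>)\<rfloor>)"
  have N_le: "real (N m) \<le> c * 2 powr (real m / \<alpha>)" for m
    using c by (simp add: N_def)
  have N_ge: "c * 2 powr (real m / \<alpha>) - 1 \<le> real (N m)" for m
    unfolding N_def by linarith
  have N_lim: "filterlim (\<lambda>m. real (N m)) at_top sequentially"
  proof (rule filterlim_at_top_mono)
    have "filterlim (\<lambda>m. (ln 2 / \<alpha>) * real m) at_top sequentially"
      using \<alpha> by (intro filterlim_tendsto_pos_mult_at_top[OF tendsto_const _ filterlim_real_sequentially]) simp
    then have "filterlim (\<lambda>m. exp ((ln 2 / \<alpha>) * real m)) at_top sequentially"
      by (rule filterlim_compose[OF exp_at_top])
    then have "filterlim (\<lambda>m. c * exp ((ln 2 / \<alpha>) * real m)) at_top sequentially"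
      by (rule filterlim_tendsto_pos_mult_at_top[OF tendsto_const \<open>c > 0\<close>])
    then have "filterlim (\<lambda>m. - 1 + c * exp ((ln 2 / \<alpha>) * real m)) at_top sequentially"
      by (rule filterlim_tendsto_add_at_top[OF tendsto_const])
    then show "filterlim (\<lambda>m. c * 2 powr (real m / \<alpha>) - 1) at_top sequentially"
      by (simp add: powr_def mult_ac)
  qed (use N_ge in simp)
  have rad: "real CARD('n) * 2 powi (- int m) \<le> real (2 * N m) powr (- \<alpha>)" if "N m > 0" for m
  proof -
    have "real CARD('n) * 2 powi (- int m) = (2 * (c * 2 powr (real m / \<alpha>))) powr (- \<alpha>)"
    proof -
      have "2 * (c * 2 powr (real m / \<alpha>)) = real CARD('n) powr (- (1 / \<alpha>)) * 2 powr (real m / \<alpha>)"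
        by (simp add: c_def)
      also have "\<dots> powr (- \<alpha>) = real CARD('n) * 2 powr (- real m)"
        using \<alpha> by (simp add: powr_mult powr_powr)
      also have "2 powr (- real m) = 2 powi (- int m)"
        using side_powr[of m 1] by simp
      finally show ?thesis by simp
    qed
    also have "\<dots> \<le> real (2 * N m) powr (- \<alpha>)"
      using N_le[of m] that \<alpha> by (intro powr_mono2') auto
    finally show ?thesis .
  qed
  let ?\<delta> = "\<lambda>m. (2 powi (- int m)) powr t :: real"
  let ?J = "\<lambda>m. {N m..<2 * N m}"
  define \<C> where "\<C> = (\<lambda>m. {C \<in> heavy_cubes P A l (?\<delta> m) m. C \<subseteq> D})"
  define b where "b = (\<lambda>C. v * (measure \<mu> (A \<inter> C) / v) powr \<eta>)"
  define F1 where "F1 = (\<lambda>m C. {\<omega>\<in>space M. (1 + e) * (real (card (?J m)) * b C)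
      \<le> real (card {k\<in>?J m. X k \<omega> \<in> A \<inter> C})})"
  define F2 where "F2 = (\<lambda>m. {\<omega>\<in>space M. (1 + e') * (real (card (?J m)) * b')
      \<le> real (card {k\<in>?J m. X k \<omega> \<in> - good_points P A D t m})})"
  have \<delta>: "?\<delta> m > 0" for m by simp
  have fin\<C>: "finite (\<C> m)" and card\<C>: "real (card (\<C> m)) \<le> real (m + nat (1 - l)) * 2 powr (real m * t)" for m
  proof -
    show "finite (\<C> m)" using heavy_cubes_card(1)[OF \<delta> A] by (auto simp: \<C>_def)
    have "real (card (\<C> m)) \<le> real (card (heavy_cubes P A l (?\<delta> m) m))"
      unfolding \<C>_def using heavy_cubes_card(1)[OF \<delta> A] by (intro of_nat_mono card_mono) auto
    also have "\<dots> \<le> real (m + nat (1 - l)) / ?\<delta> m"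
      using heavy_cubes_card(2)[OF \<delta> A] by (simp add: pos_le_divide_eq)
    also have "\<dots> = real (m + nat (1 - l)) * 2 powr (real m * t)"
      unfolding side_powr by (simp add: powr_minus divide_inverse)
    finally show "real (card (\<C> m)) \<le> real (m + nat (1 - l)) * 2 powr (real m * t)" .
  qed
  have hit: "M.prob (X k -` S \<inter> space M) = measure \<mu> S" if "k \<ge> 1" "S \<in> sets borel" for k S
  proof -
    have "X k \<in> M \<rightarrow>\<^sub>M borel" using ind that by (auto simp: M.indep_vars_def)
    then show ?thesis using that distr[OF that(1)] by (metis measure_distr)
  qed
  have \<C>D: "C \<in> sets borel \<and> C \<subseteq> D \<and> ?\<delta> m \<le> measure \<mu> (A \<inter> C) \<and> measure \<mu> (A \<inter> C) \<le> v" if "C \<in> \<C> m" for C m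
  proof -
    have "C \<in> dyadic_cubes P" "C \<subseteq> D" "?\<delta> m \<le> measure \<mu> (A \<inter> C)"
      using that dyadic_cubes_of_subset unfolding \<C>_def heavy_cubes_def by blast+
    moreover have "measure \<mu> (A \<inter> C) \<le> v"
      unfolding v_def using A Db \<open>C \<subseteq> D\<close> by (intro finite_measure_mono) (auto simp: sets_eq)
    ultimately show ?thesis using dyadic_cube_borel by auto
  qed
  have b_ge: "measure \<mu> (A \<inter> C) \<le> b C" if "C \<in> \<C> m" for C m
  proof -
    define y where "y = measure \<mu> (A \<inter> C) / v"
    have y: "0 \<le> y" "y \<le> 1" using \<C>D[OF that] v by (auto simp: y_def)
    have "y powr 1 \<le> y powr \<eta>" using y \<eta> by (intro powr_mono') auto
    then have "v * y \<le> v * y powr \<eta>" using y v by (intro mult_left_mono) auto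
    then show ?thesis using v by (simp add: b_def y_def)
  qed
  have b_low: "v * 2 powr (- (real m * t * \<eta>)) \<le> b C" if "C \<in> \<C> m" for C m
  proof -
    have "2 powr (- (real m * t)) \<le> measure \<mu> (A \<inter> C)" using \<C>D[OF that] by (simp add: side_powr)
    also have "\<dots> \<le> measure \<mu> (A \<inter> C) / v" using v by (simp add: pos_le_divide_eq mult_left_le)
    finally have "(2 powr (- (real m * t))) powr \<eta> \<le> (measure \<mu> (A \<inter> C) / v) powr \<eta>"
      using \<eta> by (intro powr_mono2) auto
    then show ?thesis using v by (simp add: b_def powr_powr)
  qed
  obtain m0 where m0: "\<And>m. m0 \<le> m \<Longrightarrow> (1 - e / 2) * v \<le> measure \<mu> (good_points P A D t m)"
    "\<And>m. m0 \<le> m \<Longrightarrow> real (max k0 1) \<le> real (N m)"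
  proof -
    have "(1 - e / 2) * v < measure \<mu> (A \<inter> D)" using lt_v by (simp add: v_def)
    note ev = good_points_tendsto[OF null D A t(1) this]
    have "\<forall>\<^sub>F m in sequentially. real (max k0 1) \<le> real (N m)"
      using N_lim unfolding filterlim_at_top by blast
    with ev have "\<forall>\<^sub>F m in sequentially. (1 - e / 2) * v \<le> measure \<mu> (good_points P A D t m)
        \<and> real (max k0 1) \<le> real (N m)"
      by (rule eventually_conj)
    then show ?thesis using that by (auto simp: eventually_sequentially)
  qed
  have J: "?J m \<subseteq> {1..}" "finite (?J m)" "card (?J m) = N m" if "m0 \<le> m" for m
    using m0(2)[OF that] by auto
  have F1: "F1 m C \<in> M.events" "M.prob (F1 m C) \<le> exp (- (real (N m) * b C * e\<^sup>2 / 4))"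
    if "m0 \<le> m" "C \<in> \<C> m" for m C
  proof -
    have AC: "A \<inter> C \<in> sets borel" using \<C>D[OF that(2)] A by auto
    have p: "M.prob (X k -` (A \<inter> C) \<inter> space M) \<le> b C" if "k \<in> ?J m" for k
      using hit[of k "A \<inter> C"] AC b_ge[OF \<open>C \<in> \<C> m\<close>] J(1)[OF \<open>m0 \<le> m\<close>] that by force
    note ch = M.chernoff_count[OF ind J(2)[OF \<open>m0 \<le> m\<close>] J(1)[OF \<open>m0 \<le> m\<close>] AC p e(1)]
    show "F1 m C \<in> M.events" unfolding F1_def by (rule ch(2)) (use e in auto)
    show "M.prob (F1 m C) \<le> exp (- (real (N m) * b C * e\<^sup>2 / 4))"
      using ch(1) e(2) unfolding F1_def J(3)[OF \<open>m0 \<le> m\<close>] by simp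
  qed
  have F2: "F2 m \<in> M.events" "M.prob (F2 m) \<le> exp (- (real (N m) * b' * e'\<^sup>2 / 4))"
    if "m0 \<le> m" for m
  proof -
    have G: "good_points P A D t m \<in> sets borel" by (rule good_points_borel[OF D A])
    then have AC: "- good_points P A D t m \<in> sets borel" by simp
    have "measure \<mu> (- good_points P A D t m) = 1 - measure \<mu> (good_points P A D t m)"
      using prob_compl[of "good_points P A D t m"] G by (simp add: sets_eq Compl_eq_Diff_UNIV)
    then have "measure \<mu> (- good_points P A D t m) \<le> b'" using m0(1)[OF that] by (simp add: b'_def)
    then have p: "M.prob (X k -` (- good_points P A D t m) \<inter> space M) \<le> b'" if "k \<in> ?J m" for k
      using hit[of k, OF _ AC] J(1)[OF \<open>m0 \<le> m\<close>] that by force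
    note ch = M.chernoff_count[OF ind J(2)[OF \<open>m0 \<le> m\<close>] J(1)[OF \<open>m0 \<le> m\<close>] AC p e']
    show "F2 m \<in> M.events" unfolding F2_def by (rule ch(2))
    show "M.prob (F2 m) \<le> exp (- (real (N m) * b' * e'\<^sup>2 / 4))"
      using ch(1) unfolding F2_def J(3)[OF \<open>m0 \<le> m\<close>] by simp
  qed
  define F where "F = (\<lambda>m. (\<Union>C\<in>\<C> m. F1 m C) \<union> F2 m)"
  have Fev: "F m \<in> M.events" if "m0 \<le> m" for m
    unfolding F_def using F1(1)[OF that] F2(1)[OF that] fin\<C> by (intro sets.Un sets.finite_UN) auto
  define a where "a = v * c * e\<^sup>2 / 4"
  have a: "a > 0" using v c e by (simp add: a_def)
  define bound where "bound = (\<lambda>m. exp (v * e\<^sup>2 / 4)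
       * (real (m + nat (1 - l)) * 2 powr (real m * t) * exp (- (a * 2 powr (real m * \<gamma>))))
       + exp (- (b' * e'\<^sup>2 / 4 * real (N m))))"
  have Fprob: "M.prob (F m) \<le> bound m" if "m0 \<le> m" for m
  proof -
    have "M.prob (F m) \<le> M.prob (\<Union>C\<in>\<C> m. F1 m C) + M.prob (F2 m)"
      unfolding F_def using F1(1)[OF that] F2(1)[OF that] fin\<C>
      by (intro measure_Un_le sets.finite_UN) auto
    also have "M.prob (\<Union>C\<in>\<C> m. F1 m C) \<le> (\<Sum>C\<in>\<C> m. M.prob (F1 m C))"
      using F1(1)[OF that] fin\<C> by (intro M.finite_measure_subadditive_finite) auto
    also have "\<dots> \<le> (\<Sum>C\<in>\<C> m. exp (v * e\<^sup>2 / 4) * exp (- (a * 2 powr (real m * \<gamma>))))"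
    proof (rule sum_mono)
      fix C assume C: "C \<in> \<C> m"
      define w where "w = 2 powr (- (real m * t * \<eta>))"
      have w: "0 < w" "w \<le> 1" using t \<eta> powr_mono[of "- (real m * t * \<eta>)" 0 2] by (auto simp: w_def)
      have "v * (c * 2 powr (real m * \<gamma>) - 1) \<le> v * ((c * 2 powr (real m / \<alpha>) - 1) * w)"
      proof -
        have "2 powr (real m / \<alpha>) * w = 2 powr (real m * \<gamma>)"
          unfolding w_def \<gamma>_def powr_add[symmetric] by (simp add: algebra_simps)
        then have "(c * 2 powr (real m / \<alpha>) - 1) * w = c * 2 powr (real m * \<gamma>) - w"
          by (simp add: algebra_simps)
        then show ?thesis using w v by simp
      qed
      also have "\<dots> \<le> v * (real (N m) * w)"
        using N_ge[of m] w v by (intro mult_left_mono mult_right_mono) auto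
      also have "\<dots> = real (N m) * (v * w)" by simp
      also have "\<dots> \<le> real (N m) * b C"
        using b_low[OF C] by (intro mult_left_mono) (auto simp: w_def)
      finally have "v * (c * 2 powr (real m * \<gamma>) - 1) * (e\<^sup>2 / 4) \<le> real (N m) * b C * (e\<^sup>2 / 4)"
        by (intro mult_right_mono) auto
      then have "- (real (N m) * b C * e\<^sup>2 / 4) \<le> v * e\<^sup>2 / 4 + - (a * 2 powr (real m * \<gamma>))"
        by (simp add: a_def algebra_simps)
      then have "exp (- (real (N m) * b C * e\<^sup>2 / 4)) \<le> exp (v * e\<^sup>2 / 4) * exp (- (a * 2 powr (real m * \<gamma>)))"
        unfolding exp_add[symmetric] by simp
      then show "M.prob (F1 m C) \<le> exp (v * e\<^sup>2 / 4) * exp (- (a * 2 powr (real m * \<gamma>)))"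
        using F1(2)[OF that C] by (rule order_trans[rotated])
    qed
    also have "\<dots> = real (card (\<C> m)) * (exp (v * e\<^sup>2 / 4) * exp (- (a * 2 powr (real m * \<gamma>))))"
      by simp
    also have "\<dots> \<le> real (m + nat (1 - l)) * 2 powr (real m * t) * (exp (v * e\<^sup>2 / 4) * exp (- (a * 2 powr (real m * \<gamma>))))"
      by (intro mult_right_mono card\<C>) auto
    finally show ?thesis using F2(2)[OF that] by (simp add: bound_def mult_ac)
  qed
  have "bound \<longlonglongrightarrow> exp (v * e\<^sup>2 / 4) * 0 + 0"
    unfolding bound_def
  proof (intro tendsto_add tendsto_mult tendsto_const exp_double_exp_tendsto_0 a \<gamma>)
    have "filterlim (\<lambda>m. b' * e'\<^sup>2 / 4 * real (N m)) at_top sequentially"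
      using b' e' by (intro filterlim_tendsto_pos_mult_at_top[OF tendsto_const _ N_lim]) auto
    then have "filterlim (\<lambda>m. - (b' * e'\<^sup>2 / 4 * real (N m))) at_bot sequentially"
      by (simp add: filterlim_uminus_at_bot)
    then show "(\<lambda>m. exp (- (b' * e'\<^sup>2 / 4 * real (N m)))) \<longlonglongrightarrow> 0"
      by (rule filterlim_compose[OF exp_at_bot])
  qed
  then have bl: "bound \<longlonglongrightarrow> 0" by simp
  have "(\<lambda>m. M.prob (F m)) \<longlonglongrightarrow> 0"
    by (rule tendsto_sandwich[OF _ _ tendsto_const bl])
       (use Fprob in \<open>auto simp: eventually_sequentially\<close>)
  then show ?thesis
  proof (rule M.AE_of_vanishing_failure[of m0 F, rotated])
    fix m \<omega> assume m: "m0 \<le> m" and \<omega>: "\<omega> \<in> space M" "\<omega> \<notin> F m"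
    have N: "N m > 0" "k0 \<le> N m" using m0(2)[OF m] by auto
    show "\<exists>m K q. frostman_family P (\<lambda>S. measure \<mu> (A \<inter> S)) \<eta>
       (\<Union>n\<in>{k0..}. ball (X n \<omega>) (real n powr (- \<alpha>))) D \<epsilon> m K q"
    proof (rule frostman_family_of_sample[OF A l pos e(1,2) N rad[OF N(1)] \<alpha>, unfolded e(3)])
      have "real (card {k\<in>?J m. X k \<omega> \<in> - good_points P A D t m}) < (1 + e') * (real (N m) * b')"
        using \<omega> J(3)[OF m] by (auto simp: F_def F2_def)
      also have "\<dots> \<le> real (N m) * (1 - (1 - e) * v)"
      proof -
        have "e' * b' \<le> e' * 1" using b' e' by (intro mult_left_mono) auto
        then have "(1 + e') * b' \<le> 1 - (1 - e) * v"
          by (simp add: algebra_simps) (simp add: b'_def e'_def algebra_simps)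
        then have "real (N m) * ((1 + e') * b') \<le> real (N m) * (1 - (1 - e) * v)"
          by (intro mult_left_mono) auto
        then show ?thesis by (simp add: mult_ac)
      qed
      finally have few: "real (card {k\<in>?J m. X k \<omega> \<in> - good_points P A D t m}) \<le> real (N m) * (1 - (1 - e) * v)"
        by simp
      have "card (?J m) = card ({k\<in>?J m. X k \<omega> \<in> good_points P A D t m}
          \<union> {k\<in>?J m. X k \<omega> \<in> - good_points P A D t m})"
        by (rule arg_cong[of _ _ card]) auto
      also have "\<dots> \<le> card {k\<in>?J m. X k \<omega> \<in> good_points P A D t m}
          + card {k\<in>?J m. X k \<omega> \<in> - good_points P A D t m}"
        by (rule card_Un_le)
      finally have "N m \<le> card {k\<in>?J m. X k \<omega> \<in> good_points P A D t m}
          + card {k\<in>?J m. X k \<omega> \<in> - good_points P A D t m}"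
        unfolding J(3)[OF m] .
      then have "real (N m) \<le> real (card {k\<in>?J m. X k \<omega> \<in> good_points P A D t m})
          + real (card {k\<in>?J m. X k \<omega> \<in> - good_points P A D t m})"
        by (simp only: of_nat_add[symmetric] of_nat_le_iff)
      with few show "real (N m) * ((1 - e) * measure \<mu> (A \<inter> D))
          \<le> real (card {k\<in>?J m. X k \<omega> \<in> good_points P A D t m})"
        by (simp add: v_def algebra_simps)
    next
      fix C assume C: "C \<in> heavy_cubes P A l (?\<delta> m) m" "C \<subseteq> D"
      then have "C \<in> \<C> m" by (simp add: \<C>_def)
      then have "\<omega> \<notin> F1 m C" using \<omega> by (auto simp: F_def)
      then show "real (card {k\<in>?J m. X k \<omega> \<in> A \<inter> C})
          \<le> (1 + e) * (real (N m) * (measure \<mu> (A \<inter> D) * (measure \<mu> (A \<inter> C) / measure \<mu> (A \<inter> D)) powr \<eta>))"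
        using \<omega> J(3)[OF m] by (auto simp: F1_def b_def v_def)
    qed
  qed (use Fev in auto)
qed

lemma AE_spreads:
  fixes P :: "real^'n" and M :: "'w measure" and X :: "nat \<Rightarrow> 'w \<Rightarrow> real^'n"
  assumes "prob_space M" "prob_space.indep_vars M (\<lambda>_. borel) X {1..}"
    "\<And>n. n \<ge> 1 \<Longrightarrow> distr M borel (X n) = \<mu>"
    "emeasure \<mu> (dyadic_boundaries P) = 0" "A \<in> sets borel"
    "D \<in> dyadic_cubes P" "measure \<mu> (A \<inter> D) > 0" "\<alpha> > 0" "0 < \<eta>" "\<eta> \<le> 1"
    "critical_s \<mu> < ereal t" "t > 0" "\<alpha> * t * \<eta> < 1"
  shows "AE \<omega> in M. spreads P (\<lambda>S. measure \<mu> (A \<inter> S)) \<eta>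
       (\<Union>n\<in>{k0..}. ball (X n \<omega>) (real n powr (- \<alpha>))) D"
proof -
  have "AE \<omega> in M. \<forall>j. \<exists>m K q. frostman_family P (\<lambda>S. measure \<mu> (A \<inter> S)) \<eta>
       (\<Union>n\<in>{k0..}. ball (X n \<omega>) (real n powr (- \<alpha>))) D (1 / real (Suc j)) m K q"
    unfolding AE_all_countable by (intro allI AE_frostman_family[OF assms]) auto
  then show ?thesis
  proof (rule AE_mp, intro AE_I2 impI)
    fix \<omega> assume *: "\<forall>j. \<exists>m K q. frostman_family P (\<lambda>S. measure \<mu> (A \<inter> S)) \<eta>
       (\<Union>n\<in>{k0..}. ball (X n \<omega>) (real n powr (- \<alpha>))) D (1 / real (Suc j)) m K q"
    show "spreads P (\<lambda>S. measure \<mu> (A \<inter> S)) \<eta> (\<Union>n\<in>{k0..}. ball (X n \<omega>) (real n powr (- \<alpha>))) D"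
      unfolding spreads_def
    proof (intro allI impI)
      fix \<epsilon> :: real assume "\<epsilon> > 0"
      then obtain j where j: "1 / real (Suc j) < \<epsilon>" using nat_approx_posE by blast
      from * obtain m K q where "frostman_family P (\<lambda>S. measure \<mu> (A \<inter> S)) \<eta>
         (\<Union>n\<in>{k0..}. ball (X n \<omega>) (real n powr (- \<alpha>))) D (1 / real (Suc j)) m K q" by blast
      from frostman_family_mono_eps[OF this, of \<epsilon>] j
      show "\<exists>m K q. frostman_family P (\<lambda>S. measure \<mu> (A \<inter> S)) \<eta>
         (\<Union>n\<in>{k0..}. ball (X n \<omega>) (real n powr (- \<alpha>))) D \<epsilon> m K q" by auto
    qed
  qed
qed

end

section \<open>Local dimension\<close>

context borel_prob
begin

lemma measure_ball_inner:
  assumes "a < measure \<mu> (ball x r)" "0 < r"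
  obtains s where "0 < s" "s < r" "a < measure \<mu> (ball x s)"
proof -
  define b where "b = (\<lambda>n. ball x (r * (1 - 1 / real (Suc (Suc n)))))"
  have "incseq b"
    unfolding b_def using assms(2)
    by (intro incseq_SucI subset_ball mult_left_mono) (auto simp: field_simps)
  then have "(\<lambda>n. measure \<mu> (b n)) \<longlonglongrightarrow> measure \<mu> (\<Union>n. b n)"
    by (intro finite_Lim_measure_incseq) (auto simp: b_def sets_eq)
  also have "(\<Union>n. b n) = ball x r"
  proof (intro equalityI subsetI)
    fix y assume "y \<in> (\<Union>n. b n)"
    then obtain n where "dist x y < r * (1 - 1 / real (Suc (Suc n)))" by (auto simp: b_def)
    also have "\<dots> \<le> r * 1" using assms(2) by (intro mult_left_mono) auto
    finally show "y \<in> ball x r" by simp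
  next
    fix y assume "y \<in> ball x r"
    then have "0 < 1 - dist x y / r" using assms(2) by simp
    then obtain n where n: "1 / real (Suc n) < 1 - dist x y / r" using nat_approx_posE by blast
    have "1 / real (Suc (Suc n)) \<le> 1 / real (Suc n)" by (simp add: field_simps)
    then have "dist x y / r < 1 - 1 / real (Suc (Suc n))" using n by linarith
    then have "dist x y < r * (1 - 1 / real (Suc (Suc n)))"
      using assms(2) by (simp add: pos_divide_less_eq mult.commute)
    then show "y \<in> (\<Union>n. b n)" by (auto simp: b_def)
  qed
  finally have "\<forall>\<^sub>F n in sequentially. a < measure \<mu> (b n)"
    using assms(1) by (rule order_tendstoD(1))
  then obtain n where n: "a < measure \<mu> (b n)" by (auto simp: eventually_sequentially)
  show ?thesis
    by (rule that[of "r * (1 - 1 / real (Suc (Suc n)))"])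
       (use n assms(2) in \<open>auto simp: b_def mult_less_cancel_left2\<close>)
qed

lemma measure_ball_measurable: "0 < r \<Longrightarrow> (\<lambda>x. measure \<mu> (ball x r)) \<in> borel_measurable borel"
proof (subst borel_measurable_iff_greater, intro allI)
  fix a assume r: "0 < r"
  have "open {x. a < measure \<mu> (ball x r)}"
    unfolding open_dist
  proof (intro ballI)
    fix x assume "x \<in> {x. a < measure \<mu> (ball x r)}"
    then obtain s where s: "s < r" "a < measure \<mu> (ball x s)"
      using measure_ball_inner[OF _ r] by blast
    have "a < measure \<mu> (ball y r)" if "dist y x < r - s" for y
    proof -
      have "ball x s \<subseteq> ball y r"
      proof
        fix z assume "z \<in> ball x s"
        then show "z \<in> ball y r" using that dist_triangle[of y z x] by simp
      qed
      then show ?thesis using s(2) finite_measure_mono[of "ball x s" "ball y r"] by (simp add: sets_eq)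
    qed
    then show "\<exists>e>0. \<forall>y. dist y x < e \<longrightarrow> y \<in> {x. a < measure \<mu> (ball x r)}"
      using s(1) by (intro exI[of _ "r - s"]) auto
  qed
  then show "{x \<in> space borel. a < measure \<mu> (ball x r)} \<in> sets borel" by simp
qed

lemma elog_measurable: "elog \<in> borel_measurable borel"
  unfolding elog_def[abs_def] by measurable

definition local_quotient :: "real^'n \<Rightarrow> real \<Rightarrow> ereal" where
  "local_quotient x r = elog (measure \<mu> (ball x r)) / ereal (ln r)"

lemma local_quotient_less_iff:
  assumes "0 < r" "r < 1"
  shows "local_quotient x r < ereal y \<longleftrightarrow> r powr y < measure \<mu> (ball x r)"
proof -
  have lr: "ln r < 0" using assms by simp
  show ?thesis
  proof (cases "measure \<mu> (ball x r) = 0")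
    case True
    then have "local_quotient x r = \<infinity>" using lr by (simp add: local_quotient_def elog_def)
    then show ?thesis using True by (simp add: not_less)
  next
    case False
    then have p: "measure \<mu> (ball x r) > 0" by (simp add: zero_less_measure_iff)
    then have "local_quotient x r = ereal (ln (measure \<mu> (ball x r)) / ln r)"
      using lr by (simp add: local_quotient_def elog_def)
    then have "local_quotient x r < ereal y \<longleftrightarrow> y * ln r < ln (measure \<mu> (ball x r))"
      using lr by (simp add: neg_divide_less_eq)
    also have "\<dots> \<longleftrightarrow> exp (y * ln r) < measure \<mu> (ball x r)"
      using p by (metis exp_less_cancel_iff exp_ln)
    finally show ?thesis using assms by (simp add: powr_def)
  qed
qed

text \<open>The mass of an open ball is left-continuous in the radius, so a lower bound at the rational radii
  extends to all radii. This reduces the lower local dimension to countably many radii and makes it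
  measurable.\<close>
lemma local_quotient_ge_real:
  assumes \<delta>: "\<delta> \<le> 1" and c: "\<And>q. q \<in> \<rat> \<Longrightarrow> 0 < q \<Longrightarrow> q < \<delta> \<Longrightarrow> c \<le> local_quotient x q"
    and r: "0 < r" "r < \<delta>"
  shows "c \<le> local_quotient x r"
proof (rule ccontr)
  assume "\<not> ?thesis"
  then obtain y where y: "local_quotient x r < ereal y" "ereal y < c"
    using ereal_dense2 by (metis not_le)
  have "r powr y < measure \<mu> (ball x r)"
    using y(1) local_quotient_less_iff[of r x y] r \<delta> by simp
  then obtain b where b: "r powr y < b" "b < measure \<mu> (ball x r)" using dense by blast
  obtain s where s: "0 < s" "s < r" "b < measure \<mu> (ball x s)"
    using measure_ball_inner[OF b(2) r(1)] by blast
  have "((\<lambda>q. q powr y) \<longlongrightarrow> r powr y) (at_left r)"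
    using r by (intro tendsto_intros) auto
  then have "\<forall>\<^sub>F q in at_left r. q powr y < b" using b(1) by (rule order_tendstoD(2))
  then obtain s' where s': "s' < r" "\<And>q. s' < q \<Longrightarrow> q < r \<Longrightarrow> q powr y < b"
    by (auto simp: eventually_at_left_field)
  obtain q where q: "q \<in> \<rat>" "max s s' < q" "q < r"
    using Rats_dense_in_real[of "max s s'" r] s s' by auto
  have "q powr y < b" using s'(2) q by auto
  also have "b < measure \<mu> (ball x s)" by (rule s(3))
  also have "\<dots> \<le> measure \<mu> (ball x q)"
    using q by (intro finite_measure_mono) (auto simp: sets_eq)
  finally have "local_quotient x q < ereal y"
    using local_quotient_less_iff[of q x y] q s r \<delta> by simp
  then show False using c[of q] q s r y(2) by (meson leD less_trans max_less_iff_conj order_less_le_trans)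
qed

text \<open>Needed because \<open>esssup\<close> is meaningful only for measurable functions.\<close>
lemma lower_local_dim_measurable: "lower_local_dim \<mu> \<in> borel_measurable borel"
proof -
  define \<delta> where "\<delta> = (\<lambda>n. 1 / real (Suc n))"
  have \<delta>: "0 < \<delta> n" "\<delta> n \<le> 1" for n by (auto simp: \<delta>_def field_simps)
  define I where "I = (\<lambda>n. {q\<in>\<rat>. 0 < q \<and> q < \<delta> n})"
  have eq: "lower_local_dim \<mu> x = (SUP n. INF q\<in>I n. local_quotient x q)" for x
  proof (rule antisym)
    show "lower_local_dim \<mu> x \<le> (SUP n. INF q\<in>I n. local_quotient x q)"
    proof (rule dense_le)
      fix y assume "y < lower_local_dim \<mu> x"
      then have "\<forall>\<^sub>F r in at_right 0. y < local_quotient x r"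
        unfolding lower_local_dim_def local_quotient_def by (rule less_LiminfD)
      then obtain d where d: "d > 0" "\<And>r. 0 < r \<Longrightarrow> r < d \<Longrightarrow> y < local_quotient x r"
        by (auto simp: eventually_at_right_field)
      obtain n where n: "\<delta> n < d" using d(1) nat_approx_posE unfolding \<delta>_def by blast
      have "y \<le> (INF q\<in>I n. local_quotient x q)"
        using d(2) n by (intro INF_greatest) (auto simp: I_def intro: less_imp_le)
      also have "\<dots> \<le> (SUP n. INF q\<in>I n. local_quotient x q)" by (intro SUP_upper) simp
      finally show "y \<le> (SUP n. INF q\<in>I n. local_quotient x q)" .
    qed
    show "(SUP n. INF q\<in>I n. local_quotient x q) \<le> lower_local_dim \<mu> x"
    proof (rule SUP_least)
      fix n
      have "(INF q\<in>I n. local_quotient x q) \<le> local_quotient x r" if "0 < r" "r < \<delta> n" for r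
        by (rule local_quotient_ge_real[OF \<delta>(2) _ that]) (auto simp: I_def intro: INF_lower)
      then show "(INF q\<in>I n. local_quotient x q) \<le> lower_local_dim \<mu> x"
        unfolding lower_local_dim_def local_quotient_def
        using \<delta>(1)[of n] by (intro Liminf_bounded eventually_at_rightI[of 0 "\<delta> n"]) (auto simp: local_quotient_def)
    qed
  qed
  have "(\<lambda>x. local_quotient x q) \<in> borel_measurable borel" if "0 < q" for q
    unfolding local_quotient_def
    using measurable_compose[OF measure_ball_measurable[OF that] elog_measurable] by measurable
  moreover have "countable (I n)" for n
    using countable_rat by (rule countable_subset[rotated]) (auto simp: I_def)
  ultimately have "(\<lambda>x. SUP n. INF q\<in>I n. local_quotient x q) \<in> borel_measurable borel"
    by (intro borel_measurable_SUP borel_measurable_INF) (auto simp: I_def)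
  then show ?thesis using eq by (simp add: fun_eq_iff[symmetric] cong: measurable_cong)
qed

definition frostman_set :: "real \<Rightarrow> real \<Rightarrow> (real^'n) set" where
  "frostman_set t \<delta> = {x. \<forall>r. 0 < r \<and> r < \<delta> \<longrightarrow> measure \<mu> (ball x r) \<le> r powr t}"

lemma closed_frostman_set: "closed (frostman_set t \<delta>)"
proof -
  have "x \<in> frostman_set t \<delta>" if x: "x \<in> closure (frostman_set t \<delta>)" for x
    unfolding frostman_set_def
  proof (rule CollectI, intro allI impI, rule ccontr)
    fix r assume r: "0 < r \<and> r < \<delta>" and "\<not> measure \<mu> (ball x r) \<le> r powr t"
    then obtain s where s: "s < r" "r powr t < measure \<mu> (ball x s)"
      using measure_ball_inner[of "r powr t" x r] by (auto simp: not_le)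
    obtain y where y: "y \<in> frostman_set t \<delta>" "dist y x < r - s"
      using x s(1) unfolding closure_approachable by (metis diff_gt_0_iff_gt)
    have "ball x s \<subseteq> ball y r"
    proof
      fix z assume "z \<in> ball x s"
      then show "z \<in> ball y r" using y(2) dist_triangle[of y z x] by simp
    qed
    then have "measure \<mu> (ball x s) \<le> measure \<mu> (ball y r)"
      by (intro finite_measure_mono) (auto simp: sets_eq)
    also have "\<dots> \<le> r powr t" using y(1) r by (auto simp: frostman_set_def)
    finally show False using s(2) by simp
  qed
  then show ?thesis by (metis closure_subset_eq subsetI)
qed

lemma frostman_set_nonnull:
  assumes t: "ereal t < upper_hausdorff_dim \<mu>"
  obtains \<delta> where "\<delta> > 0" "measure \<mu> (frostman_set t \<delta>) > 0"
proof (rule ccontr)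
  assume neg: "\<not> thesis"
  define S where "S = (\<lambda>j. frostman_set t (1 / real (Suc j)))"
  have "S j \<in> null_sets \<mu>" for j
  proof -
    have "\<not> measure \<mu> (S j) > 0" using neg that[of "1 / real (Suc j)"] by (auto simp: S_def)
    then have "measure \<mu> (S j) = 0" by (simp add: zero_less_measure_iff)
    then show ?thesis using closed_frostman_set
      by (simp add: null_sets_def S_def sets_eq emeasure_eq_measure)
  qed
  then have "(\<Union>j. S j) \<in> null_sets \<mu>" by (intro null_sets_UN) auto
  then have "AE x in \<mu>. x \<notin> (\<Union>j. S j)" by (rule AE_not_in)
  then have "AE x in \<mu>. lower_local_dim \<mu> x \<le> ereal t"
  proof eventually_elim
    case (elim x)
    show ?case
    proof (rule ccontr)
      assume "\<not> lower_local_dim \<mu> x \<le> ereal t"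
      then have "ereal t < lower_local_dim \<mu> x" by simp
      then have "\<forall>\<^sub>F r in at_right 0. ereal t < local_quotient x r"
        unfolding lower_local_dim_def local_quotient_def by (rule less_LiminfD)
      then obtain d where d: "d > 0" "\<And>r. 0 < r \<Longrightarrow> r < d \<Longrightarrow> ereal t < local_quotient x r"
        by (auto simp: eventually_at_right_field)
      obtain j where j: "1 / real (Suc j) < d" using d(1) nat_approx_posE by blast
      have "1 / real (Suc j) \<le> 1" by (simp add: field_simps)
      have "x \<in> S j"
        unfolding S_def frostman_set_def
      proof (rule CollectI, intro allI impI)
        fix r assume r: "0 < r \<and> r < 1 / real (Suc j)"
        then have "ereal t < local_quotient x r" using d(2) j by auto
        moreover have "0 < r" "r < 1"
          using r order_less_le_trans[OF _ \<open>1 / real (Suc j) \<le> 1\<close>] by blast+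
        ultimately have "\<not> r powr t < measure \<mu> (ball x r)"
          using local_quotient_less_iff[of r x t] by (meson less_asym)
        then show "measure \<mu> (ball x r) \<le> r powr t" by simp
      qed
      with elim show False by blast
    qed
  qed
  moreover have "lower_local_dim \<mu> \<in> borel_measurable \<mu>"
    using lower_local_dim_measurable measurable_cong_sets[OF sets_eq refl] by blast
  ultimately have "upper_hausdorff_dim \<mu> \<le> ereal t"
    unfolding upper_hausdorff_dim_def by (intro esssup_I)
  then show False using t by simp
qed

end

section \<open>Lower bound for Hausdorff measure\<close>

lemma sum_geometric_injective_le_1:
  fixes n :: "'a \<Rightarrow> nat"
  assumes "finite G" "inj_on n G"
  shows "(\<Sum>U\<in>G. (1 / 2 :: real) ^ Suc (n U)) \<le> 1"
proof -
  have "(\<Sum>U\<in>G. (1 / 2 :: real) ^ Suc (n U)) = (\<Sum>k\<in>n ` G. (1 / 2) ^ Suc k)"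
    by (rule sum.reindex_cong[OF assms(2) refl, symmetric]) simp
  also have "\<dots> \<le> (\<Sum>k. (1 / 2) ^ Suc k)"
    using assms(1) power_half_series by (intro sum_le_suminf) (auto simp: sums_iff)
  also have "\<dots> = 1" using power_half_series by (simp add: sums_iff)
  finally show ?thesis .
qed

text \<open>The side of the cubes is the power of \<open>2\<close> between \<open>\<rho>\<close> and \<open>2 \<rho>\<close>, so the index of a point of
  \<open>U\<close> differs by at most one from that of \<open>p\<close> in each coordinate.\<close>
lemma dyadic_cover_of_small_set:
  fixes P p :: "real^'n"
  assumes \<rho>: "\<rho> > 0" and U: "\<And>y. y \<in> U \<Longrightarrow> dist p y \<le> \<rho>"
  obtains F where "finite F" "card F \<le> 3 ^ CARD('n)" "F \<subseteq> dyadic_cubes P" "U \<subseteq> \<Union>F"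
    "\<And>C. C \<in> F \<Longrightarrow> C \<subseteq> ball p (4 * real CARD('n) * \<rho>)"
proof -
  define n where "n = \<lfloor>- log 2 \<rho>\<rfloor>"
  define r where "r = (2 powi (- n) :: real)"
  have r_eq: "r = 2 powr (- of_int n)"
    unfolding r_def by (simp add: powr_real_of_int' flip: of_int_minus)
  have \<rho>_eq: "\<rho> = 2 powr log 2 \<rho>" using \<rho> by simp
  have r: "r > 0" by (simp add: r_def)
  have "log 2 \<rho> \<le> - of_int n" "- of_int n \<le> 1 + log 2 \<rho>" unfolding n_def by linarith+
  then have "2 powr log 2 \<rho> \<le> r" "r \<le> 2 powr (1 + log 2 \<rho>)" unfolding r_eq by auto
  then have r\<rho>: "\<rho> \<le> r" "r \<le> 2 * \<rho>" using \<rho> by (auto simp: powr_add)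
  define F where "F = (\<lambda>e. cell r P (\<lambda>i. index r P p i + e i)) ` (PiE UNIV (\<lambda>_. {-1..1}))"
  have fin: "finite (PiE UNIV (\<lambda>_::'n. {-1..1::int}))" by (intro finite_PiE) auto
  show ?thesis
  proof (rule that[of F])
    show "finite F" using fin by (simp add: F_def)
    have "card F \<le> card (PiE UNIV (\<lambda>_::'n. {-1..1::int}))"
      unfolding F_def by (rule card_image_le[OF fin])
    then show "card F \<le> 3 ^ CARD('n)" by (simp add: card_PiE)
    show "F \<subseteq> dyadic_cubes P"
      using cell_in_dyadic_cubes_of dyadic_cubes_of_subset unfolding F_def r_def by blast
    show "U \<subseteq> \<Union>F"
    proof
      fix y assume y: "y \<in> U"
      have "index r P y i - index r P p i \<in> {-1..1}" for i
      proof -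
        have "\<bar>p $ i - y $ i\<bar> \<le> dist p y"
          using component_le_norm_cart[of "p - y" i] by (simp add: dist_norm)
        also have "\<dots> \<le> r" using U[OF y] r\<rho> by simp
        finally have "\<bar>(y $ i - P $ i) / r - (p $ i - P $ i) / r\<bar> \<le> 1"
          using r by (simp add: abs_le_iff field_simps diff_divide_distrib[symmetric])
        moreover have "\<bar>a - b\<bar> \<le> 1 \<Longrightarrow> \<lfloor>a\<rfloor> - \<lfloor>b\<rfloor> \<in> {-1..1}" for a b :: real
          by (simp add: abs_le_iff) linarith
        ultimately show ?thesis by blast
      qed
      then have e: "(\<lambda>i. index r P y i - index r P p i) \<in> PiE UNIV (\<lambda>_. {-1..1})" by auto
      have "y \<in> cell r P (\<lambda>i. index r P p i + (index r P y i - index r P p i))"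
        by (simp add: mem_cell_iff)
      with e show "y \<in> \<Union>F" unfolding F_def by blast
    qed
  next
    fix C assume "C \<in> F"
    then obtain e where "e \<in> PiE UNIV (\<lambda>_::'n. {-1..1::int})" and C: "C = cell r P (\<lambda>i. index r P p i + e i)"
      unfolding F_def by blast
    then have e: "e i \<in> {-1..1}" for i by (simp add: PiE_iff)
    show "C \<subseteq> ball p (4 * real CARD('n) * \<rho>)"
    proof
      fix y assume "y \<in> C"
      then have y: "\<And>i. index r P y i = index r P p i + e i"
        by (auto simp: C cell_def)
      have "\<bar>p $ i - y $ i\<bar> < 4 * \<rho>" for i
      proof -
        define a b where "a = (y $ i - P $ i) / r" and "b = (p $ i - P $ i) / r"
        have "\<bar>\<lfloor>a\<rfloor> - \<lfloor>b\<rfloor>\<bar> \<le> 1" using e[of i] y[of i] by (simp add: a_def b_def abs_le_iff)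
        then have "\<bar>b - a\<bar> < 2" by linarith
        then have "r * \<bar>b - a\<bar> < r * 2" using r by simp
        moreover have "p $ i - y $ i = r * (b - a)" using r by (simp add: a_def b_def field_simps)
        ultimately have "\<bar>p $ i - y $ i\<bar> < r * 2" using r by (simp add: abs_mult)
        then show ?thesis using r\<rho> by simp
      qed
      then have "dist p y < real CARD('n) * (4 * \<rho>)" by (rule dist_le_coord_bound)
      then show "y \<in> ball p (4 * real CARD('n) * \<rho>)" by (simp add: mult_ac)
    qed
  qed
qed

context borel_prob
begin

text \<open>A cover of \<open>E\<close> with small sum of \<open>diameter U powr a\<close> is converted into a cover of
  \<open>E \<inter> frostman_set t \<delta> \<inter> D\<close> by dyadic cubes with small sum, contradicting \<open>content\<close>. The radii \<open>\<rho> U\<close> enlarge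
  the powers \<open>diameter U powr a\<close> by summable amounts, because a set of diameter \<open>0\<close> cannot be replaced
  by cubes of size \<open>0\<close>.\<close>
lemma hausdorff_measure_nonzero:
  fixes E :: "(real^'n) set"
  assumes content: "\<And>CC. CC \<subseteq> dyadic_cubes P \<Longrightarrow> E \<inter> frostman_set t \<delta> \<inter> D \<subseteq> \<Union>CC \<Longrightarrow>
      ennreal c \<le> infsum (\<lambda>C. ennreal (measure \<mu> (frostman_set t \<delta> \<inter> C) powr \<eta>)) CC"
    and c: "c > 0" and \<delta>: "\<delta> > 0" and t: "t > 0" and \<eta>: "\<eta> > 0" and a: "0 < a" "a \<le> t * \<eta>"
  shows "hausdorff_measure a E \<noteq> 0"
proof
  assume "hausdorff_measure a E = 0"
  then have pre: "hausdorff_premeasure a 1 E = 0"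
    unfolding hausdorff_measure_def by (metis SUP_upper greaterThan_iff le_zero_eq zero_less_one)
  define A where "A = frostman_set t \<delta>"
  have Ab: "A \<in> sets borel" unfolding A_def by (intro borel_closed closed_frostman_set)
  define d where "d = 4 * real CARD('n)"
  have d: "d > 0" by (simp add: d_def)
  \<comment> \<open>A bound on the radii \<open>\<rho> U\<close> below which the dyadic cubes obey the mass bound that defines the
    Frostman set.\<close>
  define \<kappa> where "\<kappa> = min 1 (\<delta> / (2 * d))"
  have \<kappa>: "0 < \<kappa>" "\<kappa> \<le> 1" "d * \<kappa> < \<delta>"
  proof -
    show "0 < \<kappa>" "\<kappa> \<le> 1" using \<delta> d by (auto simp: \<kappa>_def)
    have "d * \<kappa> \<le> d * (\<delta> / (2 * d))" using d by (intro mult_left_mono) (auto simp: \<kappa>_def)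
    also have "\<dots> < \<delta>" using d \<delta> by simp
    finally show "d * \<kappa> < \<delta>" .
  qed
  \<comment> \<open>The factor lost in passing from a set of the cover to its dyadic cubes.\<close>
  define K where "K = 3 ^ CARD('n) * d powr (t * \<eta>)"
  have K: "K > 0" using d by (simp add: K_def)
  define \<epsilon> where "\<epsilon> = min (\<kappa> powr a / 2) (c / (4 * K))"
  have \<epsilon>: "\<epsilon> > 0" "2 * \<epsilon> \<le> \<kappa> powr a" "K * (2 * \<epsilon>) < c"
  proof -
    show "\<epsilon> > 0" "2 * \<epsilon> \<le> \<kappa> powr a" using \<kappa> c K by (auto simp: \<epsilon>_def)
    have "K * (2 * \<epsilon>) \<le> K * (2 * (c / (4 * K)))"
      using K by (intro mult_left_mono) (auto simp: \<epsilon>_def)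
    also have "\<dots> < c" using K c by simp
    finally show "K * (2 * \<epsilon>) < c" .
  qed
  have "hausdorff_premeasure a 1 E < ennreal \<epsilon>" using pre \<epsilon> by simp
  then obtain UU where UU: "countable UU" "\<And>U. U \<in> UU \<Longrightarrow> bounded U" "E \<subseteq> \<Union>UU"
    and sumUU: "infsum (\<lambda>U. ennreal (diameter U powr a)) UU < ennreal \<epsilon>"
    unfolding hausdorff_premeasure_def by (auto simp: INF_less_iff)
  have sumG: "(\<Sum>U\<in>G. diameter U powr a) \<le> \<epsilon>" if "finite G" "G \<subseteq> UU" for G
  proof -
    have "ennreal (\<Sum>U\<in>G. diameter U powr a) = (\<Sum>U\<in>G. ennreal (diameter U powr a))" by simp
    also have "\<dots> \<le> infsum (\<lambda>U. ennreal (diameter U powr a)) UU"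
      using that by (rule sum_le_ennreal_infsum)
    also have "\<dots> \<le> ennreal \<epsilon>" using sumUU by simp
    finally show ?thesis using \<epsilon> by (simp add: ennreal_le_iff)
  qed
  define w where "w = (\<lambda>U. diameter U powr a + \<epsilon> * (1 / 2) ^ Suc (to_nat_on UU U))"
  define \<rho> where "\<rho> = (\<lambda>U. w U powr (1 / a))"
  have w: "0 < w U" "w U \<le> 2 * \<epsilon>" if "U \<in> UU" for U
  proof -
    show "0 < w U" using \<epsilon> by (simp add: w_def add_nonneg_pos)
    have "diameter U powr a \<le> \<epsilon>" using sumG[of "{U}"] that by simp
    moreover have "\<epsilon> * (1 / 2) ^ Suc (to_nat_on UU U) \<le> \<epsilon> * 1"
      using \<epsilon> by (intro mult_left_mono power_le_one) auto
    ultimately show "w U \<le> 2 * \<epsilon>" by (simp add: w_def)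
  qed
  have \<rho>: "0 < \<rho> U" "\<rho> U powr a = w U" "diameter U \<le> \<rho> U" "\<rho> U \<le> \<kappa>" if "U \<in> UU" for U
  proof -
    show "0 < \<rho> U" using w[OF that] by (simp add: \<rho>_def)
    show "\<rho> U powr a = w U" using w[OF that] a by (simp add: \<rho>_def powr_powr)
    have "diameter U = (diameter U powr a) powr (1 / a)"
      using a diameter_ge_0[OF UU(2)[OF that]] by (simp add: powr_powr)
    also have "\<dots> \<le> \<rho> U"
      unfolding \<rho>_def w_def using a \<epsilon> by (intro powr_mono2) auto
    finally show "diameter U \<le> \<rho> U" .
    have "\<rho> U \<le> (\<kappa> powr a) powr (1 / a)"
      unfolding \<rho>_def using a w[OF that] \<epsilon> by (intro powr_mono2) auto
    then show "\<rho> U \<le> \<kappa>" using a \<kappa> by (simp add: powr_powr)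
  qed
  define f where "f = (\<lambda>C. ennreal (measure \<mu> (A \<inter> C) powr \<eta>))"
  have "\<exists>F. F \<subseteq> dyadic_cubes P \<and> U \<inter> A \<subseteq> \<Union>F \<and> infsum f F \<le> ennreal (K * w U)" if U: "U \<in> UU" for U
  proof (cases "U \<inter> A = {}")
    case True
    then show ?thesis by (intro exI[of _ "{}"]) auto
  next
    case False
    then obtain p where p: "p \<in> U" "p \<in> A" by auto
    have "dist p y \<le> \<rho> U" if "y \<in> U" for y
      using diameter_bounded_bound[OF UU(2)[OF U] p(1) that] \<rho>(3)[OF U] by simp
    from dyadic_cover_of_small_set[OF \<rho>(1)[OF U] this, of U P] obtain F
      where F: "finite F" "card F \<le> 3 ^ CARD('n)" "F \<subseteq> dyadic_cubes P" "U \<subseteq> \<Union>F"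
        "\<And>C. C \<in> F \<Longrightarrow> C \<subseteq> ball p (d * \<rho> U)" unfolding d_def by blast
    have fC: "measure \<mu> (A \<inter> C) powr \<eta> \<le> d powr (t * \<eta>) * w U" if "C \<in> F" for C
    proof -
      have "measure \<mu> (A \<inter> C) \<le> measure \<mu> (ball p (d * \<rho> U))"
        using F(5)[OF that] by (intro finite_measure_mono) (auto simp: sets_eq)
      also have "\<dots> \<le> (d * \<rho> U) powr t"
      proof -
        have "d * \<rho> U \<le> d * \<kappa>" using \<rho>(4)[OF U] d by (intro mult_left_mono) auto
        also note \<kappa>(3)
        finally have "0 < d * \<rho> U \<and> d * \<rho> U < \<delta>" using d \<rho>(1)[OF U] by simp
        then show ?thesis using p(2) unfolding A_def frostman_set_def by blast
      qed
      finally have "measure \<mu> (A \<inter> C) powr \<eta> \<le> ((d * \<rho> U) powr t) powr \<eta>"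
        using \<eta> by (intro powr_mono2) auto
      also have "\<dots> = d powr (t * \<eta>) * \<rho> U powr (t * \<eta>)"
        using d \<rho>(1)[OF U] by (simp add: powr_powr powr_mult)
      also have "\<dots> \<le> d powr (t * \<eta>) * \<rho> U powr a"
        using \<rho>(1,4)[OF U] \<kappa>(2) a by (intro mult_left_mono powr_mono') auto
      finally show ?thesis using \<rho>(2)[OF U] by simp
    qed
    have "infsum f F = sum f F" using F(1) by simp
    also have "\<dots> \<le> (\<Sum>C\<in>F. ennreal (d powr (t * \<eta>) * w U))"
      unfolding f_def by (intro sum_mono ennreal_leI fC)
    also have "\<dots> = ennreal (real (card F) * (d powr (t * \<eta>) * w U))"
      using w[OF U] by (simp add: ennreal_mult' ennreal_of_nat_eq_real_of_nat)
    also have "\<dots> \<le> ennreal (3 ^ CARD('n) * (d powr (t * \<eta>) * w U))"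
    proof (intro ennreal_leI mult_right_mono)
      have "real (card F) \<le> real (3 ^ CARD('n))" using F(2) by (simp only: of_nat_le_iff)
      then show "real (card F) \<le> 3 ^ CARD('n)" by simp
    qed (use w[OF U] in auto)
    finally show ?thesis using F by (intro exI[of _ F]) (auto simp: K_def mult_ac)
  qed
  then have "\<forall>U\<in>UU. \<exists>F. F \<subseteq> dyadic_cubes P \<and> U \<inter> A \<subseteq> \<Union>F \<and> infsum f F \<le> ennreal (K * w U)" by blast
  from bchoice[OF this] obtain F where F: "\<And>U. U \<in> UU \<Longrightarrow>
     F U \<subseteq> dyadic_cubes P \<and> U \<inter> A \<subseteq> \<Union>(F U) \<and> infsum f (F U) \<le> ennreal (K * w U)" by auto
  have "ennreal c \<le> infsum f (\<Union>U\<in>UU. F U)"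
    unfolding f_def A_def
  proof (rule content)
    show "(\<Union>U\<in>UU. F U) \<subseteq> dyadic_cubes P" using F by blast
    show "E \<inter> frostman_set t \<delta> \<inter> D \<subseteq> \<Union>(\<Union>U\<in>UU. F U)"
      using UU(3) F unfolding A_def by blast
  qed
  also have "\<dots> \<le> infsum (\<lambda>U. infsum f (F U)) UU" by (rule ennreal_infsum_UN_le)
  also have "\<dots> \<le> ennreal (K * (2 * \<epsilon>))"
  proof (rule ennreal_infsum_le)
    fix G assume G: "finite G" "G \<subseteq> UU"
    have "(\<Sum>U\<in>G. infsum f (F U)) \<le> (\<Sum>U\<in>G. ennreal (K * w U))"
      using F G by (intro sum_mono) auto
    also have "\<dots> = ennreal (\<Sum>U\<in>G. K * w U)"
      using w(1) G K by (intro sum_ennreal) (auto intro!: mult_nonneg_nonneg less_imp_le)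
    also have "(\<Sum>U\<in>G. K * w U) = K * ((\<Sum>U\<in>G. diameter U powr a) + \<epsilon> * (\<Sum>U\<in>G. (1 / 2) ^ Suc (to_nat_on UU U)))"
      unfolding w_def sum_distrib_left[of K, symmetric] sum_distrib_left[of \<epsilon>, symmetric] sum.distrib ..
    also have "ennreal \<dots> \<le> ennreal (K * (\<epsilon> + \<epsilon> * 1))"
      using K \<epsilon> sumG[OF G] inj_on_subset[OF inj_on_to_nat_on[OF UU(1)] G(2)]
      by (intro ennreal_leI mult_left_mono add_mono sum_geometric_injective_le_1 G) auto
    finally show "(\<Sum>U\<in>G. infsum f (F U)) \<le> ennreal (K * (2 * \<epsilon>))" by simp
  qed
  finally show False using \<epsilon>(3) K \<epsilon>(1) c by (simp add: ennreal_le_iff)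
qed

end

section \<open>Membership in the class and the dimension bound\<close>

lemma limsup_balls_eq:
  "limsup_balls x \<alpha> = (\<Inter>k. \<Union>n\<in>{Suc k..}. ball (x n) (real n powr (- \<alpha>)))"
proof -
  have "{1..} = range Suc" by (auto simp: image_iff Suc_le_eq gr0_conv_Suc)
  then show ?thesis unfolding limsup_balls_def by simp
qed

lemma gdelta_in_limsup_balls: "gdelta_in euclidean (limsup_balls x \<alpha>)"
  unfolding limsup_balls_eq
  by (intro gdelta_in_Inter) (auto intro!: open_imp_gdelta_in open_UN)

context borel_prob
begin

text \<open>The exceptional null sets are collected over countably many cubes, indices and rational exponents;
  the other exponents follow by \<open>spreads_mono\<close>.\<close>
lemma AE_content_ge:
  fixes P :: "real^'n" and M :: "'w measure" and X :: "nat \<Rightarrow> 'w \<Rightarrow> real^'n"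
  assumes M: "prob_space M" and ind: "prob_space.indep_vars M (\<lambda>_. borel) X {1..}"
    and distr: "\<And>n. n \<ge> 1 \<Longrightarrow> distr M borel (X n) = \<mu>"
    and null: "emeasure \<mu> (dyadic_boundaries P) = 0" and A: "closed A"
    and \<alpha>: "\<alpha> > 0" and s: "critical_s \<mu> = ereal s" "s > 0" "1 / \<alpha> \<le> s"
  shows "AE \<omega> in M. \<forall>\<eta> D CC. 0 < \<eta> \<longrightarrow> \<eta> < 1 / (\<alpha> * s) \<longrightarrow> D \<in> dyadic_cubes P \<longrightarrow>
      CC \<subseteq> dyadic_cubes P \<longrightarrow> limsup_balls (\<lambda>n. X n \<omega>) \<alpha> \<inter> A \<inter> D \<subseteq> \<Union>CC \<longrightarrow>
      ennreal (measure \<mu> (A \<inter> D) powr \<eta>) \<le> infsum (\<lambda>C. ennreal (measure \<mu> (A \<inter> C) powr \<eta>)) CC"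
proof -
  let ?U = "\<lambda>k \<omega>. \<Union>n\<in>{Suc k..}. ball (X n \<omega>) (real n powr (- \<alpha>))"
  let ?\<nu> = "\<lambda>S. measure \<mu> (A \<inter> S)"
  define DD where "DD = {D\<in>dyadic_cubes P. ?\<nu> D > 0}"
  define Z where "Z = {\<zeta>\<in>\<rat>. 0 < \<zeta> \<and> \<zeta> < 1 / (\<alpha> * s)}"
  have Ab: "A \<in> sets borel" using A by simp
  have mono: "?\<nu> C \<le> ?\<nu> D" if "D \<in> dyadic_cubes P" "C \<subseteq> D" for C D
    using that Ab dyadic_cube_borel[of D P] by (intro finite_measure_mono) (auto simp: sets_eq)
  have cDD: "countable DD" using countable_dyadic_cubes by (rule countable_subset[rotated]) (auto simp: DD_def)
  have cZ: "countable Z" using countable_rat by (rule countable_subset[rotated]) (auto simp: Z_def)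
  have "AE \<omega> in M. \<forall>D\<in>DD. \<forall>\<zeta>\<in>Z. \<forall>k. spreads P ?\<nu> \<zeta> (?U k \<omega>) D"
    unfolding AE_ball_countable[OF cDD] AE_ball_countable[OF cZ] AE_all_countable
  proof (intro ballI allI)
    fix D \<zeta> k assume D: "D \<in> DD" and \<zeta>: "\<zeta> \<in> Z"
    have z: "0 < \<zeta>" "\<zeta> < 1 / (\<alpha> * s)" using \<zeta> by (auto simp: Z_def)
    have "1 \<le> \<alpha> * s" using s(3) \<alpha> by (simp add: field_simps)
    then have "1 / (\<alpha> * s) \<le> 1" using \<alpha> s(2) by simp
    then have z1: "\<zeta> \<le> 1" using z by linarith
    have "s < 1 / (\<alpha> * \<zeta>)" using z \<alpha> s(2) by (simp add: field_simps)
    then obtain t where t: "s < t" "t < 1 / (\<alpha> * \<zeta>)" using dense by blast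
    have "\<alpha> * t * \<zeta> < 1" using t(2) z \<alpha> by (simp add: field_simps)
    moreover have "critical_s \<mu> < ereal t" using t s(1) by simp
    moreover have "0 < t" using t s(2) by simp
    ultimately show "AE \<omega> in M. spreads P ?\<nu> \<zeta> (?U k \<omega>) D"
      using D by (intro AE_spreads[OF M ind distr null Ab _ _ \<alpha> z(1) z1]) (auto simp: DD_def)
  qed
  then show ?thesis
  proof eventually_elim
    case (elim \<omega>)
    show ?case
    proof (intro allI impI)
      fix \<eta> D CC
      assume \<eta>: "0 < \<eta>" "\<eta> < 1 / (\<alpha> * s)" and D: "D \<in> dyadic_cubes P" and CC: "CC \<subseteq> dyadic_cubes P"
        and cover: "limsup_balls (\<lambda>n. X n \<omega>) \<alpha> \<inter> A \<inter> D \<subseteq> \<Union>CC"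
      obtain \<zeta> where \<zeta>: "\<zeta> \<in> \<rat>" "\<eta> < \<zeta>" "\<zeta> < 1 / (\<alpha> * s)" using Rats_dense_in_real[OF \<eta>(2)] by auto
      have spr: "spreads P ?\<nu> \<eta> (?U k \<omega>) D'" if D': "D' \<in> dyadic_cubes P" "?\<nu> D' > 0" for D' k
      proof -
        have "spreads P ?\<nu> \<zeta> (?U k \<omega>) D'" using elim D' \<zeta> \<eta> by (auto simp: DD_def Z_def)
        then show ?thesis by (rule spreads_mono) (use \<zeta> D' mono in auto)
      qed
      show "ennreal (?\<nu> D powr \<eta>) \<le> infsum (\<lambda>C. ennreal (?\<nu> C powr \<eta>)) CC"
      proof (rule content_ge_of_spreads[where \<nu> = ?\<nu> and U = "\<lambda>k. ?U k \<omega>", OF spr _ _ A _ _ D CC])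
        show "Q \<inter> A \<noteq> {}" if "0 < ?\<nu> Q" for Q using that by (auto simp: Int_commute)
        show "(\<Inter>k. ?U k \<omega>) \<inter> A \<inter> D \<subseteq> \<Union>CC" using cover unfolding limsup_balls_eq .
      qed (use mono \<eta> in auto)
    qed
  qed
qed

lemma exists_dyadic_cube_nonnull:
  assumes A: "A \<in> sets borel" "measure \<mu> A > 0"
  obtains D where "D \<in> dyadic_cubes P" "measure \<mu> (A \<inter> D) > 0"
proof (rule ccontr)
  assume neg: "\<not> thesis"
  note witness = that
  have "A \<inter> D \<in> null_sets \<mu>" if "D \<in> dyadic_cubes P" for D
  proof -
    have "\<not> 0 < measure \<mu> (A \<inter> D)" using neg witness[OF that] by blast
    then have "measure \<mu> (A \<inter> D) = 0" by (simp add: zero_less_measure_iff)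
    then show ?thesis using A dyadic_cube_borel[OF that]
      by (simp add: null_sets_def sets_eq emeasure_eq_measure)
  qed
  then have "(\<Union>D\<in>dyadic_cubes P. A \<inter> D) \<in> null_sets \<mu>"
    by (intro null_sets_UN' countable_dyadic_cubes)
  moreover have "(\<Union>D\<in>dyadic_cubes P. A \<inter> D) = A"
  proof -
    have "x \<in> \<Union>(dyadic_cubes P)" for x
      using mem_cell_index[of x "2 powi (- 0)" P] cell_in_dyadic_cubes_of[of 0 P] dyadic_cubes_of_subset[of P 0] by blast
    then show ?thesis by auto
  qed
  ultimately show False using A(2) by (simp add: measure_def null_sets_def)
qed

end

theorem theorem2p8:
  fixes P :: "real^'n"
    and \<mu> :: "(real^'n) measure"
    and \<alpha> :: real
    and M :: "'w measure"
    and X :: "nat \<Rightarrow> 'w \<Rightarrow> real^'n"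
  assumes "prob_space \<mu>" and "sets \<mu> = sets borel"
    and "non_atomic \<mu>"
    and "emeasure \<mu> (dyadic_boundaries P) = 0"
    and "\<alpha> > 0"
    and "prob_space M"
    and "prob_space.indep_vars M (\<lambda>_. borel) X {1..}"
    and "\<And>n. n \<ge> 1 \<Longrightarrow> distr M borel (X n) = \<mu>"
    and "ereal (1 / \<alpha>) \<le> critical_s \<mu>"
  shows "AE \<omega> in M.
      limsup_balls (\<lambda>n. X n \<omega>) \<alpha> \<in> class_G P \<mu> (real_of_ereal (1 / (ereal \<alpha> * critical_s \<mu>))) \<and>
      hausdorff_dim (limsup_balls (\<lambda>n. X n \<omega>) \<alpha>)
        \<ge> ereal (1 / \<alpha>) * (upper_hausdorff_dim \<mu> / critical_s \<mu>)"
proof (cases "critical_s \<mu> = \<infinity>")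
  case True
  \<comment> \<open>Here \<open>1 / \<infinity> = 0\<close>, so the class consists of all \<open>G\<^sub>\<delta>\<close>-sets and the dimension bound is \<open>0\<close>.\<close>
  have "0 \<le> hausdorff_dim E" for E :: "(real^'n) set"
    unfolding hausdorff_dim_def by (intro INF_greatest) auto
  then show ?thesis
    using True assms(5) gdelta_in_limsup_balls by (auto simp: class_G_def)
next
  case False
  interpret borel_prob \<mu>
    using assms(1,2) by (simp add: borel_prob_def borel_prob_axioms_def)
  obtain s where s: "critical_s \<mu> = ereal s" "1 / \<alpha> \<le> s"
    using False assms(9) by (cases "critical_s \<mu>") auto
  have s0: "s > 0" using s(2) assms(5) by (meson less_le_trans zero_less_divide_1_iff)
  define \<theta> where "\<theta> = 1 / (\<alpha> * s)"
  have \<theta>: "real_of_ereal (1 / (ereal \<alpha> * critical_s \<mu>)) = \<theta>"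
    using s(1) s0 assms(5) by (simp add: \<theta>_def one_ereal_def)
  note content = AE_content_ge[OF assms(6,7,8,4) _ assms(5) s(1) s0 s(2), folded \<theta>_def]
  define T where "T = {t\<in>\<rat>. 0 < t \<and> ereal t < upper_hausdorff_dim \<mu>}"
  have "\<forall>t\<in>T. \<exists>\<delta>. \<delta> > 0 \<and> measure \<mu> (frostman_set t \<delta>) > 0"
    using frostman_set_nonnull by (metis (mono_tags, lifting) T_def mem_Collect_eq)
  from bchoice[OF this] obtain \<delta> where
    \<delta>: "\<And>t. t \<in> T \<Longrightarrow> \<delta> t > 0 \<and> measure \<mu> (frostman_set t (\<delta> t)) > 0" by auto
  have cT: "countable T" using countable_rat by (rule countable_subset[rotated]) (auto simp: T_def)
  let ?E = "\<lambda>\<omega>. limsup_balls (\<lambda>n. X n \<omega>) \<alpha>"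
  have "AE \<omega> in M. \<forall>t\<in>T. \<forall>\<eta> D CC. 0 < \<eta> \<longrightarrow> \<eta> < \<theta> \<longrightarrow> D \<in> dyadic_cubes P \<longrightarrow>
      CC \<subseteq> dyadic_cubes P \<longrightarrow> ?E \<omega> \<inter> frostman_set t (\<delta> t) \<inter> D \<subseteq> \<Union>CC \<longrightarrow>
      ennreal (measure \<mu> (frostman_set t (\<delta> t) \<inter> D) powr \<eta>)
        \<le> infsum (\<lambda>C. ennreal (measure \<mu> (frostman_set t (\<delta> t) \<inter> C) powr \<eta>)) CC"
    unfolding AE_ball_countable[OF cT] by (intro ballI content closed_frostman_set)
  moreover have "AE \<omega> in M. \<forall>\<eta> D CC. 0 < \<eta> \<longrightarrow> \<eta> < \<theta> \<longrightarrow> D \<in> dyadic_cubes P \<longrightarrow>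
      CC \<subseteq> dyadic_cubes P \<longrightarrow> ?E \<omega> \<inter> UNIV \<inter> D \<subseteq> \<Union>CC \<longrightarrow>
      ennreal (measure \<mu> (UNIV \<inter> D) powr \<eta>) \<le> infsum (\<lambda>C. ennreal (measure \<mu> (UNIV \<inter> C) powr \<eta>)) CC"
    by (intro content) auto
  ultimately show ?thesis
  proof eventually_elim
    case (elim \<omega>)
    have "?E \<omega> \<in> class_G P \<mu> \<theta>"
      unfolding class_G_def
    proof (intro CollectI conjI allI impI gdelta_in_limsup_balls)
      fix \<eta> D assume *: "0 < \<eta> \<and> \<eta> < \<theta> \<and> D \<in> dyadic_cubes P"
      have "dyadic_content P \<mu> \<eta> D \<le> ennreal (measure \<mu> D powr \<eta>)"
        unfolding dyadic_content_def by (rule INF_lower2[of "{D}"]) (use * in auto)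
      also have "\<dots> \<le> dyadic_content P \<mu> \<eta> (?E \<omega> \<inter> D)"
        unfolding dyadic_content_def using elim(2) * by (intro INF_greatest) simp
      finally have "dyadic_content P \<mu> \<eta> D \<le> dyadic_content P \<mu> \<eta> (?E \<omega> \<inter> D)" .
      moreover have "dyadic_content P \<mu> \<eta> (?E \<omega> \<inter> D) \<le> dyadic_content P \<mu> \<eta> D"
        unfolding dyadic_content_def by (intro INF_superset_mono) auto
      ultimately show "dyadic_content P \<mu> \<eta> (?E \<omega> \<inter> D) = dyadic_content P \<mu> \<eta> D" by (rule antisym[rotated])
    qed
    moreover have "ereal (1 / \<alpha>) * (upper_hausdorff_dim \<mu> / critical_s \<mu>) \<le> hausdorff_dim (?E \<omega>)"
      unfolding hausdorff_dim_def
    proof (rule INF_greatest, rule ccontr)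
      fix a assume "a \<in> {a. 0 < a \<and> hausdorff_measure a (?E \<omega>) = 0}"
      then have a: "0 < a" "hausdorff_measure a (?E \<omega>) = 0" by auto
      assume "\<not> ereal (1 / \<alpha>) * (upper_hausdorff_dim \<mu> / critical_s \<mu>) \<le> ereal a"
      then have "ereal a < ereal (1 / \<alpha>) * (upper_hausdorff_dim \<mu> / ereal s)" using s by simp
      then have "ereal (a * \<alpha> * s) < upper_hausdorff_dim \<mu>"
        using s0 assms(5) by (cases "upper_hausdorff_dim \<mu>") (auto simp: field_simps)
      then obtain u where u: "ereal (a * \<alpha> * s) < ereal u" "ereal u < upper_hausdorff_dim \<mu>"
        using ereal_dense2 by blast
      obtain t where t: "t \<in> \<rat>" "a * \<alpha> * s < t" "t < u" using Rats_dense_in_real u(1) by auto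
      have t0: "0 < t" using t(2) a(1) assms(5) s0 by (meson less_trans mult_pos_pos)
      have "ereal t < upper_hausdorff_dim \<mu>" using t(3) u(2) by (meson ereal_less_eq(3) less_imp_le order_le_less_trans)
      then have tT: "t \<in> T" using t t0 by (auto simp: T_def)
      \<comment> \<open>The exponent for which \<open>hausdorff_measure_nonzero\<close> concerns the dimension \<open>t \<eta> = a\<close>.\<close>
      define \<eta> where "\<eta> = a / t"
      have \<eta>: "0 < \<eta>" "\<eta> < \<theta>" "a \<le> t * \<eta>"
        using a t t0 s0 assms(5) by (auto simp: \<eta>_def \<theta>_def field_simps)
      obtain D where D: "D \<in> dyadic_cubes P" "measure \<mu> (frostman_set t (\<delta> t) \<inter> D) > 0"
        using exists_dyadic_cube_nonnull[of "frostman_set t (\<delta> t)"] \<delta>[OF tT] closed_frostman_set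
        by (metis borel_closed)
      have "hausdorff_measure a (?E \<omega>) \<noteq> 0"
      proof (rule hausdorff_measure_nonzero)
        fix CC assume "CC \<subseteq> dyadic_cubes P" "?E \<omega> \<inter> frostman_set t (\<delta> t) \<inter> D \<subseteq> \<Union>CC"
        then show "ennreal (measure \<mu> (frostman_set t (\<delta> t) \<inter> D) powr \<eta>)
           \<le> infsum (\<lambda>C. ennreal (measure \<mu> (frostman_set t (\<delta> t) \<inter> C) powr \<eta>)) CC"
          using elim(1) tT \<eta> D(1) by blast
      qed (use D \<delta>[OF tT] t0 \<eta> a in auto)
      then show False using a(2) by simp
    qed
    ultimately show ?case unfolding \<theta> by simp
  qed
qed

end
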